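(* Let $\mathcal{S}$ be the initial first-order model of the type theory $\mathcal{T}$, and let $\mathbb{S}^\bullet$ be a displayed higher-order model over $\mathcal{S}$. Then the displayed first-order model $\mathbf{Scone}_{\mathbb{S}^\bullet}$ over $\mathcal{S}$ admits a section.
   Context: $\mathcal{T}$ is a dependent type theory with $\Pi$-types (with $\beta$ and $\eta$). A first-order model of $\mathcal{T}$ is a category with families (CwF) with $\Pi$-types (with $\beta$, $\eta$ and stability under substitution); morphisms are CwF morphisms strictly preserving all structure; $\mathcal{S}$ is the initial such model, with terminal (empty) context $1_\mathcal{S}$. For a first-order model $\mathcal{M}$, a displayed higher-order model $\mathbb{M}^\bullet$ over $\mathcal{M}$ consists of: $\mathsf{Ty}^\bullet : \mathcal{M}.\mathsf{Ty}(1_\mathcal{M}) \to \mathrm{Set}$; $\mathsf{Tm}^\bullet(A^\bullet, a) \in \mathrm{Set}$ for $A^\bullet\in\mathsf{Ty}^\bullet(A)$ and $a \in \mathcal{M}.\mathsf{Tm}(1_\mathcal{M},A)$; $\Pi^\bullet(A^\bullet,B^\bullet) \in \mathsf{Ty}^\bullet(\Pi(A,B))$ for $B \in \mathcal{M}.\mathsf{Ty}(1_\mathcal{M}.A)$ and $B^\bullet$ a function assigning to each closed $a : A$ and $a^\bullet \in \mathsf{Tm}^\bullet(A^\bullet,a)$ an element $B^\bullet(a^\bullet)\in\mathsf{Ty}^\bullet(B[a])$; $\mathsf{app}^\bullet(f^\bullet,a^\bullet) \in \mathsf{Tm}^\bullet(B^\bullet(a^\bullet),\mathsf{app}(f,a))$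 for $f^\bullet \in \mathsf{Tm}^\bullet(\Pi^\bullet(A^\bullet,B^\bullet),f)$; $\mathsf{lam}^\bullet(b^\bullet) \in \mathsf{Tm}^\bullet(\Pi^\bullet(A^\bullet,B^\bullet),\mathsf{lam}(b))$ for $b \in \mathcal{M}.\mathsf{Tm}(1_\mathcal{M}.A, B)$ and $b^\bullet$ assigning to each $(a,a^\bullet)$ an element of $\mathsf{Tm}^\bullet(B^\bullet(a^\bullet), b[a])$; subject to $\mathsf{app}^\bullet(\mathsf{lam}^\bullet(b^\bullet),a^\bullet)=b^\bullet(a^\bullet)$ and $\mathsf{lam}^\bullet(\lambda a^\bullet\mapsto\mathsf{app}^\bullet(f^\bullet,a^\bullet))=f^\bullet$. The displayed first-order model $\mathbf{Scone}_{\mathbb{M}^\bullet}$ over $\mathcal{M}$ has: displayed objects over $\Gamma$ the families $\Gamma^\dagger : \mathcal{M}(1_\mathcal{M},\Gamma)\to\mathrm{Set}$; displayed morphisms over $f:\Gamma\to\Delta$ the families $f^\dagger : \forall \gamma,\ \Gamma^\dagger(\gamma)\to\Delta^\dagger(f\circ\gamma)$ (identity and composition pointwise); displayed types over $\Gamma^\dagger$ and $A\in\mathcal{M}.\mathsf{Ty}(\Gamma)$ the functions $A^\dagger : \forall\gamma\,(\gamma^\bullet\in\Gamma^\dagger(\gamma)) \to \mathsf{Ty}^\bullet(A[\gamma])$; displayed terms over $a$ the functions $a^\dagger : \forall\gamma\,\gamma^\bullet \to \mathsf{Tm}^\bullet(A^\dagger(\gamma^\bullet),a[\gamma])$; substitution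 by precomposition; empty context $\lambda\_\mapsto\mathbf{1}$; extension $(\Gamma^\dagger.A^\dagger)(\langle\gamma,a\rangle) = (\gamma^\bullet\in\Gamma^\dagger(\gamma))\times\mathsf{Tm}^\bullet(A^\dagger(\gamma^\bullet),a)$; and $\Pi^\dagger,\mathsf{app}^\dagger,\mathsf{lam}^\dagger$ defined pointwise from $\Pi^\bullet,\mathsf{app}^\bullet,\mathsf{lam}^\bullet$. A section $[\![-]\!]$ of $\mathbf{Scone}_{\mathbb{M}^\bullet}$ is a section of the projection in the category of first-order models; concretely: families $[\![\Gamma]\!] : \mathcal{M}(1,\Gamma)\to\mathrm{Set}$, $[\![f]\!] : \forall\gamma,\ [\![\Gamma]\!](\gamma)\to[\![\Delta]\!](f\circ\gamma)$, $[\![A]\!](\gamma^\bullet)\in\mathsf{Ty}^\bullet(A[\gamma])$, $[\![a]\!](\gamma^\bullet)\in\mathsf{Tm}^\bullet([\![A]\!](\gamma^\bullet),a[\gamma])$, such that $[\![\mathsf{id}]\!]$ and $[\![f\circ g]\!]$ are identity and composite, $[\![A[f]]\!](\gamma^\bullet)=[\![A]\!]([\![f]\!](\gamma^\bullet))$, $[\![a[f]]\!](\gamma^\bullet)=[\![a]\!]([\![f]\!](\gamma^\bullet))$, empty context and context extensions (with pairing) are preserved strictly, and $[\![\Pi(A,B)]\!](\gamma^\bullet)=\Pi^\bullet([\![A]\!](\gamma^\bullet),\lambda a^\bullet\mapsto[\![B]\!](\gamma^\bullet,a^\bullet))$, $[\![\mathsf{app}(f,a)]\!](\gamma^\bullet)=\mathsf{app}^\bullet([\![f]\!](\gamma^\bullet),[\![a]\!](\gamma^\bullet))$,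 $[\![\mathsf{lam}(b)]\!](\gamma^\bullet)=\mathsf{lam}^\bullet(\lambda a^\bullet\mapsto[\![b]\!](\gamma^\bullet,a^\bullet))$. *)

theory Defs
  imports "HOL-Library.FuncSet"
begin

section \<open>First-order models: categories with families with \<open>\<Pi>\<close>-types\<close>

text \<open>
  All hom-sets, type sets and term sets are indexed families that are not required to be disjoint.
  Each operation therefore receives the indices of its arguments explicitly.

  \<^item> \<open>cmp M \<Gamma> \<Delta> \<Theta> g f\<close> is \<open>g \<circ> f\<close> for \<open>f : \<Gamma> \<rightarrow> \<Delta>\<close> and \<open>g : \<Delta> \<rightarrow> \<Theta>\<close>.
  \<^item> \<open>ty_sub M \<Delta> \<Gamma> A f\<close> and \<open>tm_sub M \<Delta> \<Gamma> A a f\<close> are \<open>A[f]\<close> and \<open>a[f]\<close> for \<open>f : \<Delta> \<rightarrow> \<Gamma>\<close>.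
  \<^item> \<open>wk M \<Gamma> A : \<Gamma>.A \<rightarrow> \<Gamma>\<close> and \<open>vz M \<Gamma> A\<close> are the two projections \<open>p\<close> and \<open>q\<close>.
  \<^item> \<open>pairing M \<Delta> \<Gamma> A f a : \<Delta> \<rightarrow> \<Gamma>.A\<close> is \<open>\<langle>f, a\<rangle>\<close>.
\<close>

record ('o, 'm, 'ty, 'tm) cwf_pi_data =
  ob :: "'o set"
  hom :: "'o \<Rightarrow> 'o \<Rightarrow> 'm set"
  ident :: "'o \<Rightarrow> 'm"
  cmp :: "'o \<Rightarrow> 'o \<Rightarrow> 'o \<Rightarrow> 'm \<Rightarrow> 'm \<Rightarrow> 'm"
  Ty :: "'o \<Rightarrow> 'ty set"
  ty_sub :: "'o \<Rightarrow> 'o \<Rightarrow> 'ty \<Rightarrow> 'm \<Rightarrow> 'ty"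
  Tm :: "'o \<Rightarrow> 'ty \<Rightarrow> 'tm set"
  tm_sub :: "'o \<Rightarrow> 'o \<Rightarrow> 'ty \<Rightarrow> 'tm \<Rightarrow> 'm \<Rightarrow> 'tm"
  emp :: "'o"
  ext :: "'o \<Rightarrow> 'ty \<Rightarrow> 'o"
  wk :: "'o \<Rightarrow> 'ty \<Rightarrow> 'm"
  vz :: "'o \<Rightarrow> 'ty \<Rightarrow> 'tm"
  pairing :: "'o \<Rightarrow> 'o \<Rightarrow> 'ty \<Rightarrow> 'm \<Rightarrow> 'tm \<Rightarrow> 'm"
  PiT :: "'o \<Rightarrow> 'ty \<Rightarrow> 'ty \<Rightarrow> 'ty"
  lam :: "'o \<Rightarrow> 'ty \<Rightarrow> 'ty \<Rightarrow> 'tm \<Rightarrow> 'tm"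
  app :: "'o \<Rightarrow> 'ty \<Rightarrow> 'ty \<Rightarrow> 'tm \<Rightarrow> 'tm \<Rightarrow> 'tm"

text \<open>\<open>inst\<close> is \<open>\<langle>id, a\<rangle> : \<Gamma> \<rightarrow> \<Gamma>.A\<close>; \<open>lift\<close> is \<open>\<langle>f \<circ> p, q\<rangle> : \<Delta>.A[f] \<rightarrow> \<Gamma>.A\<close>.\<close>

definition inst :: "('o, 'm, 'ty, 'tm) cwf_pi_data \<Rightarrow> 'o \<Rightarrow> 'ty \<Rightarrow> 'tm \<Rightarrow> 'm" where
  "inst M \<Gamma> A a = pairing M \<Gamma> \<Gamma> A (ident M \<Gamma>) a"

definition lift :: "('o, 'm, 'ty, 'tm) cwf_pi_data \<Rightarrow> 'o \<Rightarrow> 'o \<Rightarrow> 'ty \<Rightarrow> 'm \<Rightarrow> 'm" where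
  "lift M \<Delta> \<Gamma> A f =
    (let Af = ty_sub M \<Delta> \<Gamma> A f; \<Delta>' = ext M \<Delta> Af
     in pairing M \<Delta>' \<Gamma> A (cmp M \<Delta>' \<Delta> \<Gamma> f (wk M \<Delta> Af)) (vz M \<Delta> Af))"

text \<open>\<open>ty_inst\<close> and \<open>tm_inst\<close> are \<open>B[a]\<close> and \<open>b[a]\<close>; \<open>ty_lift\<close> and \<open>tm_lift\<close> substitute along
  \<open>lift\<close>; \<open>app_vz\<close> is \<open>app (f[p], q)\<close>, a term of type \<open>B\<close> over \<open>\<Gamma>.A\<close>.\<close>

definition ty_inst :: "('o, 'm, 'ty, 'tm) cwf_pi_data \<Rightarrow> 'o \<Rightarrow> 'ty \<Rightarrow> 'ty \<Rightarrow> 'tm \<Rightarrow> 'ty" where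
  "ty_inst M \<Gamma> A B a = ty_sub M \<Gamma> (ext M \<Gamma> A) B (inst M \<Gamma> A a)"

definition tm_inst ::
  "('o, 'm, 'ty, 'tm) cwf_pi_data \<Rightarrow> 'o \<Rightarrow> 'ty \<Rightarrow> 'ty \<Rightarrow> 'tm \<Rightarrow> 'tm \<Rightarrow> 'tm" where
  "tm_inst M \<Gamma> A B b a = tm_sub M \<Gamma> (ext M \<Gamma> A) B b (inst M \<Gamma> A a)"

definition ty_lift ::
  "('o, 'm, 'ty, 'tm) cwf_pi_data \<Rightarrow> 'o \<Rightarrow> 'o \<Rightarrow> 'ty \<Rightarrow> 'ty \<Rightarrow> 'm \<Rightarrow> 'ty" where
  "ty_lift M \<Delta> \<Gamma> A B f =
    ty_sub M (ext M \<Delta> (ty_sub M \<Delta> \<Gamma> A f)) (ext M \<Gamma> A) B (lift M \<Delta> \<Gamma> A f)"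

definition tm_lift ::
  "('o, 'm, 'ty, 'tm) cwf_pi_data \<Rightarrow> 'o \<Rightarrow> 'o \<Rightarrow> 'ty \<Rightarrow> 'ty \<Rightarrow> 'tm \<Rightarrow> 'm \<Rightarrow> 'tm" where
  "tm_lift M \<Delta> \<Gamma> A B b f =
    tm_sub M (ext M \<Delta> (ty_sub M \<Delta> \<Gamma> A f)) (ext M \<Gamma> A) B b (lift M \<Delta> \<Gamma> A f)"

definition app_vz :: "('o, 'm, 'ty, 'tm) cwf_pi_data \<Rightarrow> 'o \<Rightarrow> 'ty \<Rightarrow> 'ty \<Rightarrow> 'tm \<Rightarrow> 'tm" where
  "app_vz M \<Gamma> A B f =
    app M (ext M \<Gamma> A)
      (ty_sub M (ext M \<Gamma> A) \<Gamma> A (wk M \<Gamma> A))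
      (ty_lift M (ext M \<Gamma> A) \<Gamma> A B (wk M \<Gamma> A))
      (tm_sub M (ext M \<Gamma> A) \<Gamma> (PiT M \<Gamma> A B) f (wk M \<Gamma> A))
      (vz M \<Gamma> A)"

locale cwf_pi =
  fixes M :: "('o, 'm, 'ty, 'tm) cwf_pi_data"
  assumes ident_hom: "\<Gamma> \<in> ob M \<Longrightarrow> ident M \<Gamma> \<in> hom M \<Gamma> \<Gamma>"
    and comp_hom: "\<lbrakk>\<Gamma> \<in> ob M; \<Delta> \<in> ob M; \<Theta> \<in> ob M; f \<in> hom M \<Gamma> \<Delta>; g \<in> hom M \<Delta> \<Theta>\<rbrakk>
      \<Longrightarrow> cmp M \<Gamma> \<Delta> \<Theta> g f \<in> hom M \<Gamma> \<Theta>"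
    and comp_ident_left: "\<lbrakk>\<Gamma> \<in> ob M; \<Delta> \<in> ob M; f \<in> hom M \<Gamma> \<Delta>\<rbrakk>
      \<Longrightarrow> cmp M \<Gamma> \<Delta> \<Delta> (ident M \<Delta>) f = f"
    and comp_ident_right: "\<lbrakk>\<Gamma> \<in> ob M; \<Delta> \<in> ob M; f \<in> hom M \<Gamma> \<Delta>\<rbrakk>
      \<Longrightarrow> cmp M \<Gamma> \<Gamma> \<Delta> f (ident M \<Gamma>) = f"
    and comp_assoc: "\<lbrakk>\<Gamma> \<in> ob M; \<Delta> \<in> ob M; \<Theta> \<in> ob M; \<Xi> \<in> ob M;
        f \<in> hom M \<Gamma> \<Delta>; g \<in> hom M \<Delta> \<Theta>; h \<in> hom M \<Theta> \<Xi>\<rbrakk>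
      \<Longrightarrow> cmp M \<Gamma> \<Theta> \<Xi> h (cmp M \<Gamma> \<Delta> \<Theta> g f) = cmp M \<Gamma> \<Delta> \<Xi> (cmp M \<Delta> \<Theta> \<Xi> h g) f"
    and ty_sub_Ty: "\<lbrakk>\<Delta> \<in> ob M; \<Gamma> \<in> ob M; A \<in> Ty M \<Gamma>; f \<in> hom M \<Delta> \<Gamma>\<rbrakk>
      \<Longrightarrow> ty_sub M \<Delta> \<Gamma> A f \<in> Ty M \<Delta>"
    and ty_sub_ident: "\<lbrakk>\<Gamma> \<in> ob M; A \<in> Ty M \<Gamma>\<rbrakk> \<Longrightarrow> ty_sub M \<Gamma> \<Gamma> A (ident M \<Gamma>) = A"
    and ty_sub_comp: "\<lbrakk>\<Theta> \<in> ob M; \<Delta> \<in> ob M; \<Gamma> \<in> ob M; A \<in> Ty M \<Gamma>; g \<in> hom M \<Theta> \<Delta>; f \<in> hom M \<Delta> \<Gamma>\<rbrakk>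
      \<Longrightarrow> ty_sub M \<Theta> \<Gamma> A (cmp M \<Theta> \<Delta> \<Gamma> f g) = ty_sub M \<Theta> \<Delta> (ty_sub M \<Delta> \<Gamma> A f) g"
    and tm_sub_Tm: "\<lbrakk>\<Delta> \<in> ob M; \<Gamma> \<in> ob M; A \<in> Ty M \<Gamma>; a \<in> Tm M \<Gamma> A; f \<in> hom M \<Delta> \<Gamma>\<rbrakk>
      \<Longrightarrow> tm_sub M \<Delta> \<Gamma> A a f \<in> Tm M \<Delta> (ty_sub M \<Delta> \<Gamma> A f)"
    and tm_sub_ident: "\<lbrakk>\<Gamma> \<in> ob M; A \<in> Ty M \<Gamma>; a \<in> Tm M \<Gamma> A\<rbrakk>
      \<Longrightarrow> tm_sub M \<Gamma> \<Gamma> A a (ident M \<Gamma>) = a"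
    and tm_sub_comp: "\<lbrakk>\<Theta> \<in> ob M; \<Delta> \<in> ob M; \<Gamma> \<in> ob M; A \<in> Ty M \<Gamma>; a \<in> Tm M \<Gamma> A;
        g \<in> hom M \<Theta> \<Delta>; f \<in> hom M \<Delta> \<Gamma>\<rbrakk>
      \<Longrightarrow> tm_sub M \<Theta> \<Gamma> A a (cmp M \<Theta> \<Delta> \<Gamma> f g)
        = tm_sub M \<Theta> \<Delta> (ty_sub M \<Delta> \<Gamma> A f) (tm_sub M \<Delta> \<Gamma> A a f) g"
    and emp_ob: "emp M \<in> ob M"
    and emp_terminal: "\<Gamma> \<in> ob M \<Longrightarrow> \<exists>!f. f \<in> hom M \<Gamma> (emp M)"
    and ext_ob: "\<lbrakk>\<Gamma> \<in> ob M; A \<in> Ty M \<Gamma>\<rbrakk> \<Longrightarrow> ext M \<Gamma> A \<in> ob M"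
    and wk_hom: "\<lbrakk>\<Gamma> \<in> ob M; A \<in> Ty M \<Gamma>\<rbrakk> \<Longrightarrow> wk M \<Gamma> A \<in> hom M (ext M \<Gamma> A) \<Gamma>"
    and vz_Tm: "\<lbrakk>\<Gamma> \<in> ob M; A \<in> Ty M \<Gamma>\<rbrakk>
      \<Longrightarrow> vz M \<Gamma> A \<in> Tm M (ext M \<Gamma> A) (ty_sub M (ext M \<Gamma> A) \<Gamma> A (wk M \<Gamma> A))"
    and pairing_hom: "\<lbrakk>\<Delta> \<in> ob M; \<Gamma> \<in> ob M; A \<in> Ty M \<Gamma>; f \<in> hom M \<Delta> \<Gamma>;
        a \<in> Tm M \<Delta> (ty_sub M \<Delta> \<Gamma> A f)\<rbrakk>
      \<Longrightarrow> pairing M \<Delta> \<Gamma> A f a \<in> hom M \<Delta> (ext M \<Gamma> A)"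
    and wk_pairing: "\<lbrakk>\<Delta> \<in> ob M; \<Gamma> \<in> ob M; A \<in> Ty M \<Gamma>; f \<in> hom M \<Delta> \<Gamma>;
        a \<in> Tm M \<Delta> (ty_sub M \<Delta> \<Gamma> A f)\<rbrakk>
      \<Longrightarrow> cmp M \<Delta> (ext M \<Gamma> A) \<Gamma> (wk M \<Gamma> A) (pairing M \<Delta> \<Gamma> A f a) = f"
    and vz_pairing: "\<lbrakk>\<Delta> \<in> ob M; \<Gamma> \<in> ob M; A \<in> Ty M \<Gamma>; f \<in> hom M \<Delta> \<Gamma>;
        a \<in> Tm M \<Delta> (ty_sub M \<Delta> \<Gamma> A f)\<rbrakk>
      \<Longrightarrow> tm_sub M \<Delta> (ext M \<Gamma> A) (ty_sub M (ext M \<Gamma> A) \<Gamma> A (wk M \<Gamma> A)) (vz M \<Gamma> A)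
            (pairing M \<Delta> \<Gamma> A f a) = a"
    and pairing_eta: "\<lbrakk>\<Delta> \<in> ob M; \<Gamma> \<in> ob M; A \<in> Ty M \<Gamma>; h \<in> hom M \<Delta> (ext M \<Gamma> A)\<rbrakk>
      \<Longrightarrow> pairing M \<Delta> \<Gamma> A (cmp M \<Delta> (ext M \<Gamma> A) \<Gamma> (wk M \<Gamma> A) h)
            (tm_sub M \<Delta> (ext M \<Gamma> A) (ty_sub M (ext M \<Gamma> A) \<Gamma> A (wk M \<Gamma> A)) (vz M \<Gamma> A) h) = h"
    and PiT_Ty: "\<lbrakk>\<Gamma> \<in> ob M; A \<in> Ty M \<Gamma>; B \<in> Ty M (ext M \<Gamma> A)\<rbrakk> \<Longrightarrow> PiT M \<Gamma> A B \<in> Ty M \<Gamma>"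
    and PiT_sub: "\<lbrakk>\<Delta> \<in> ob M; \<Gamma> \<in> ob M; A \<in> Ty M \<Gamma>; B \<in> Ty M (ext M \<Gamma> A); f \<in> hom M \<Delta> \<Gamma>\<rbrakk>
      \<Longrightarrow> ty_sub M \<Delta> \<Gamma> (PiT M \<Gamma> A B) f
        = PiT M \<Delta> (ty_sub M \<Delta> \<Gamma> A f) (ty_lift M \<Delta> \<Gamma> A B f)"
    and lam_Tm: "\<lbrakk>\<Gamma> \<in> ob M; A \<in> Ty M \<Gamma>; B \<in> Ty M (ext M \<Gamma> A); b \<in> Tm M (ext M \<Gamma> A) B\<rbrakk>
      \<Longrightarrow> lam M \<Gamma> A B b \<in> Tm M \<Gamma> (PiT M \<Gamma> A B)"
    and lam_sub: "\<lbrakk>\<Delta> \<in> ob M; \<Gamma> \<in> ob M; A \<in> Ty M \<Gamma>; B \<in> Ty M (ext M \<Gamma> A); b \<in> Tm M (ext M \<Gamma> A) B;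
        f \<in> hom M \<Delta> \<Gamma>\<rbrakk>
      \<Longrightarrow> tm_sub M \<Delta> \<Gamma> (PiT M \<Gamma> A B) (lam M \<Gamma> A B b) f
        = lam M \<Delta> (ty_sub M \<Delta> \<Gamma> A f) (ty_lift M \<Delta> \<Gamma> A B f) (tm_lift M \<Delta> \<Gamma> A B b f)"
    and app_Tm: "\<lbrakk>\<Gamma> \<in> ob M; A \<in> Ty M \<Gamma>; B \<in> Ty M (ext M \<Gamma> A); t \<in> Tm M \<Gamma> (PiT M \<Gamma> A B); a \<in> Tm M \<Gamma> A\<rbrakk>
      \<Longrightarrow> app M \<Gamma> A B t a \<in> Tm M \<Gamma> (ty_inst M \<Gamma> A B a)"
    and app_sub: "\<lbrakk>\<Delta> \<in> ob M; \<Gamma> \<in> ob M; A \<in> Ty M \<Gamma>; B \<in> Ty M (ext M \<Gamma> A); t \<in> Tm M \<Gamma> (PiT M \<Gamma> A B);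
        a \<in> Tm M \<Gamma> A; f \<in> hom M \<Delta> \<Gamma>\<rbrakk>
      \<Longrightarrow> tm_sub M \<Delta> \<Gamma> (ty_inst M \<Gamma> A B a) (app M \<Gamma> A B t a) f
        = app M \<Delta> (ty_sub M \<Delta> \<Gamma> A f) (ty_lift M \<Delta> \<Gamma> A B f)
            (tm_sub M \<Delta> \<Gamma> (PiT M \<Gamma> A B) t f) (tm_sub M \<Delta> \<Gamma> A a f)"
    and app_lam: "\<lbrakk>\<Gamma> \<in> ob M; A \<in> Ty M \<Gamma>; B \<in> Ty M (ext M \<Gamma> A); b \<in> Tm M (ext M \<Gamma> A) B; a \<in> Tm M \<Gamma> A\<rbrakk>
      \<Longrightarrow> app M \<Gamma> A B (lam M \<Gamma> A B b) a = tm_inst M \<Gamma> A B b a"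
    and lam_app: "\<lbrakk>\<Gamma> \<in> ob M; A \<in> Ty M \<Gamma>; B \<in> Ty M (ext M \<Gamma> A); t \<in> Tm M \<Gamma> (PiT M \<Gamma> A B)\<rbrakk>
      \<Longrightarrow> lam M \<Gamma> A B (app_vz M \<Gamma> A B t) = t"


section \<open>Morphisms and initiality\<close>

record ('o, 'm, 'ty, 'tm, 'o2, 'm2, 'ty2, 'tm2) cwf_map =
  on_ob :: "'o \<Rightarrow> 'o2"
  on_hom :: "'o \<Rightarrow> 'o \<Rightarrow> 'm \<Rightarrow> 'm2"
  on_ty :: "'o \<Rightarrow> 'ty \<Rightarrow> 'ty2"
  on_tm :: "'o \<Rightarrow> 'ty \<Rightarrow> 'tm \<Rightarrow> 'tm2"

locale cwf_pi_morphism =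
  fixes M :: "('o, 'm, 'ty, 'tm) cwf_pi_data"
    and N :: "('o2, 'm2, 'ty2, 'tm2) cwf_pi_data"
    and F :: "('o, 'm, 'ty, 'tm, 'o2, 'm2, 'ty2, 'tm2) cwf_map"
  assumes on_ob_ob: "\<Gamma> \<in> ob M \<Longrightarrow> on_ob F \<Gamma> \<in> ob N"
    and on_hom_hom: "\<lbrakk>\<Gamma> \<in> ob M; \<Delta> \<in> ob M; f \<in> hom M \<Gamma> \<Delta>\<rbrakk>
      \<Longrightarrow> on_hom F \<Gamma> \<Delta> f \<in> hom N (on_ob F \<Gamma>) (on_ob F \<Delta>)"
    and on_ty_Ty: "\<lbrakk>\<Gamma> \<in> ob M; A \<in> Ty M \<Gamma>\<rbrakk> \<Longrightarrow> on_ty F \<Gamma> A \<in> Ty N (on_ob F \<Gamma>)"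
    and on_tm_Tm: "\<lbrakk>\<Gamma> \<in> ob M; A \<in> Ty M \<Gamma>; a \<in> Tm M \<Gamma> A\<rbrakk>
      \<Longrightarrow> on_tm F \<Gamma> A a \<in> Tm N (on_ob F \<Gamma>) (on_ty F \<Gamma> A)"
    and pres_ident: "\<Gamma> \<in> ob M \<Longrightarrow> on_hom F \<Gamma> \<Gamma> (ident M \<Gamma>) = ident N (on_ob F \<Gamma>)"
    and pres_comp: "\<lbrakk>\<Gamma> \<in> ob M; \<Delta> \<in> ob M; \<Theta> \<in> ob M; f \<in> hom M \<Gamma> \<Delta>; g \<in> hom M \<Delta> \<Theta>\<rbrakk>
      \<Longrightarrow> on_hom F \<Gamma> \<Theta> (cmp M \<Gamma> \<Delta> \<Theta> g f)
        = cmp N (on_ob F \<Gamma>) (on_ob F \<Delta>) (on_ob F \<Theta>) (on_hom F \<Delta> \<Theta> g) (on_hom F \<Gamma> \<Delta> f)"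
    and pres_ty_sub: "\<lbrakk>\<Delta> \<in> ob M; \<Gamma> \<in> ob M; A \<in> Ty M \<Gamma>; f \<in> hom M \<Delta> \<Gamma>\<rbrakk>
      \<Longrightarrow> on_ty F \<Delta> (ty_sub M \<Delta> \<Gamma> A f)
        = ty_sub N (on_ob F \<Delta>) (on_ob F \<Gamma>) (on_ty F \<Gamma> A) (on_hom F \<Delta> \<Gamma> f)"
    and pres_tm_sub: "\<lbrakk>\<Delta> \<in> ob M; \<Gamma> \<in> ob M; A \<in> Ty M \<Gamma>; a \<in> Tm M \<Gamma> A; f \<in> hom M \<Delta> \<Gamma>\<rbrakk>
      \<Longrightarrow> on_tm F \<Delta> (ty_sub M \<Delta> \<Gamma> A f) (tm_sub M \<Delta> \<Gamma> A a f)
        = tm_sub N (on_ob F \<Delta>) (on_ob F \<Gamma>) (on_ty F \<Gamma> A) (on_tm F \<Gamma> A a) (on_hom F \<Delta> \<Gamma> f)"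
    and pres_emp: "on_ob F (emp M) = emp N"
    and pres_ext: "\<lbrakk>\<Gamma> \<in> ob M; A \<in> Ty M \<Gamma>\<rbrakk>
      \<Longrightarrow> on_ob F (ext M \<Gamma> A) = ext N (on_ob F \<Gamma>) (on_ty F \<Gamma> A)"
    and pres_wk: "\<lbrakk>\<Gamma> \<in> ob M; A \<in> Ty M \<Gamma>\<rbrakk>
      \<Longrightarrow> on_hom F (ext M \<Gamma> A) \<Gamma> (wk M \<Gamma> A) = wk N (on_ob F \<Gamma>) (on_ty F \<Gamma> A)"
    and pres_vz: "\<lbrakk>\<Gamma> \<in> ob M; A \<in> Ty M \<Gamma>\<rbrakk>
      \<Longrightarrow> on_tm F (ext M \<Gamma> A) (ty_sub M (ext M \<Gamma> A) \<Gamma> A (wk M \<Gamma> A)) (vz M \<Gamma> A)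
        = vz N (on_ob F \<Gamma>) (on_ty F \<Gamma> A)"
    and pres_pairing: "\<lbrakk>\<Delta> \<in> ob M; \<Gamma> \<in> ob M; A \<in> Ty M \<Gamma>; f \<in> hom M \<Delta> \<Gamma>;
        a \<in> Tm M \<Delta> (ty_sub M \<Delta> \<Gamma> A f)\<rbrakk>
      \<Longrightarrow> on_hom F \<Delta> (ext M \<Gamma> A) (pairing M \<Delta> \<Gamma> A f a)
        = pairing N (on_ob F \<Delta>) (on_ob F \<Gamma>) (on_ty F \<Gamma> A) (on_hom F \<Delta> \<Gamma> f)
            (on_tm F \<Delta> (ty_sub M \<Delta> \<Gamma> A f) a)"
    and pres_PiT: "\<lbrakk>\<Gamma> \<in> ob M; A \<in> Ty M \<Gamma>; B \<in> Ty M (ext M \<Gamma> A)\<rbrakk>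
      \<Longrightarrow> on_ty F \<Gamma> (PiT M \<Gamma> A B) = PiT N (on_ob F \<Gamma>) (on_ty F \<Gamma> A) (on_ty F (ext M \<Gamma> A) B)"
    and pres_lam: "\<lbrakk>\<Gamma> \<in> ob M; A \<in> Ty M \<Gamma>; B \<in> Ty M (ext M \<Gamma> A); b \<in> Tm M (ext M \<Gamma> A) B\<rbrakk>
      \<Longrightarrow> on_tm F \<Gamma> (PiT M \<Gamma> A B) (lam M \<Gamma> A B b)
        = lam N (on_ob F \<Gamma>) (on_ty F \<Gamma> A) (on_ty F (ext M \<Gamma> A) B) (on_tm F (ext M \<Gamma> A) B b)"
    and pres_app: "\<lbrakk>\<Gamma> \<in> ob M; A \<in> Ty M \<Gamma>; B \<in> Ty M (ext M \<Gamma> A); t \<in> Tm M \<Gamma> (PiT M \<Gamma> A B); a \<in> Tm M \<Gamma> A\<rbrakk>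
      \<Longrightarrow> on_tm F \<Gamma> (ty_inst M \<Gamma> A B a) (app M \<Gamma> A B t a)
        = app N (on_ob F \<Gamma>) (on_ty F \<Gamma> A) (on_ty F (ext M \<Gamma> A) B)
            (on_tm F \<Gamma> (PiT M \<Gamma> A B) t) (on_tm F \<Gamma> A a)"

text \<open>The components of a \<^typ>\<open>('o, 'm, 'ty, 'tm, 'o2, 'm2, 'ty2, 'tm2) cwf_map\<close> are total
  functions, so equality of morphisms out of \<open>M\<close> is agreement on the carriers of \<open>M\<close>.\<close>

definition map_eq :: "('o, 'm, 'ty, 'tm) cwf_pi_data
    \<Rightarrow> ('o, 'm, 'ty, 'tm, 'o2, 'm2, 'ty2, 'tm2) cwf_map
    \<Rightarrow> ('o, 'm, 'ty, 'tm, 'o2, 'm2, 'ty2, 'tm2) cwf_map \<Rightarrow> bool" where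
  "map_eq M F G \<longleftrightarrow>
    (\<forall>\<Gamma>\<in>ob M. on_ob F \<Gamma> = on_ob G \<Gamma>) \<and>
    (\<forall>\<Gamma>\<in>ob M. \<forall>\<Delta>\<in>ob M. \<forall>f\<in>hom M \<Gamma> \<Delta>. on_hom F \<Gamma> \<Delta> f = on_hom G \<Gamma> \<Delta> f) \<and>
    (\<forall>\<Gamma>\<in>ob M. \<forall>A\<in>Ty M \<Gamma>. on_ty F \<Gamma> A = on_ty G \<Gamma> A) \<and>
    (\<forall>\<Gamma>\<in>ob M. \<forall>A\<in>Ty M \<Gamma>. \<forall>a\<in>Tm M \<Gamma> A. on_tm F \<Gamma> A a = on_tm G \<Gamma> A a)"

definition map_id :: "('o, 'm, 'ty, 'tm, 'o, 'm, 'ty, 'tm) cwf_map" where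
  "map_id = \<lparr>on_ob = \<lambda>\<Gamma>. \<Gamma>, on_hom = \<lambda>\<Gamma> \<Delta> f. f, on_ty = \<lambda>\<Gamma> A. A, on_tm = \<lambda>\<Gamma> A a. a\<rparr>"

definition map_comp :: "('o2, 'm2, 'ty2, 'tm2, 'o3, 'm3, 'ty3, 'tm3) cwf_map
    \<Rightarrow> ('o, 'm, 'ty, 'tm, 'o2, 'm2, 'ty2, 'tm2) cwf_map
    \<Rightarrow> ('o, 'm, 'ty, 'tm, 'o3, 'm3, 'ty3, 'tm3) cwf_map" where
  "map_comp G F =
    \<lparr>on_ob = \<lambda>\<Gamma>. on_ob G (on_ob F \<Gamma>),
     on_hom = \<lambda>\<Gamma> \<Delta> f. on_hom G (on_ob F \<Gamma>) (on_ob F \<Delta>) (on_hom F \<Gamma> \<Delta> f),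
     on_ty = \<lambda>\<Gamma> A. on_ty G (on_ob F \<Gamma>) (on_ty F \<Gamma> A),
     on_tm = \<lambda>\<Gamma> A a. on_tm G (on_ob F \<Gamma>) (on_ty F \<Gamma> A) (on_tm F \<Gamma> A a)\<rparr>"

text \<open>
  HOL cannot quantify over types inside a formula, so initiality is stated relative to the category
  of first-order models whose contexts, morphisms, types and terms are drawn from four given types.
  If each carrier type of \<open>S\<close> injects into the corresponding given type, then that category contains
  an isomorphic copy of \<open>S\<close> and of every model with the same carrier types as \<open>S\<close>.
\<close>

definition initial_model :: "('o2, 'm2, 'ty2, 'tm2) cwf_pi_data itself
    \<Rightarrow> ('o, 'm, 'ty, 'tm) cwf_pi_data \<Rightarrow> bool" where
  "initial_model _ S \<longleftrightarrow> cwf_pi S \<and>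
    (\<forall>N :: ('o2, 'm2, 'ty2, 'tm2) cwf_pi_data. cwf_pi N \<longrightarrow>
      (\<exists>F. cwf_pi_morphism S N F \<and> (\<forall>G. cwf_pi_morphism S N G \<longrightarrow> map_eq S F G)))"


section \<open>Displayed first-order models and their sections\<close>

text \<open>
  Displayed operations receive each argument as a pair of a component of the base model and a
  displayed component over it.  Thus \<open>disp_hom D (\<Gamma>, \<Gamma>\<^sup>\<dagger>) (\<Delta>, \<Delta>\<^sup>\<dagger>) f\<close> is the set of displayed
  morphisms over \<open>f\<close>, and the displayed operations return only the displayed component.
\<close>

record ('o, 'm, 'ty, 'tm, 'do, 'dm, 'dty, 'dtm) displayed_data =
  disp_ob :: "'o \<Rightarrow> 'do set"
  disp_hom :: "'o \<times> 'do \<Rightarrow> 'o \<times> 'do \<Rightarrow> 'm \<Rightarrow> 'dm set"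
  disp_ident :: "'o \<times> 'do \<Rightarrow> 'dm"
  disp_comp :: "'o \<times> 'do \<Rightarrow> 'o \<times> 'do \<Rightarrow> 'o \<times> 'do \<Rightarrow> 'm \<times> 'dm \<Rightarrow> 'm \<times> 'dm \<Rightarrow> 'dm"
  disp_Ty :: "'o \<times> 'do \<Rightarrow> 'ty \<Rightarrow> 'dty set"
  disp_ty_sub :: "'o \<times> 'do \<Rightarrow> 'o \<times> 'do \<Rightarrow> 'ty \<times> 'dty \<Rightarrow> 'm \<times> 'dm \<Rightarrow> 'dty"
  disp_Tm :: "'o \<times> 'do \<Rightarrow> 'ty \<times> 'dty \<Rightarrow> 'tm \<Rightarrow> 'dtm set"
  disp_tm_sub :: "'o \<times> 'do \<Rightarrow> 'o \<times> 'do \<Rightarrow> 'ty \<times> 'dty \<Rightarrow> 'tm \<times> 'dtm \<Rightarrow> 'm \<times> 'dm \<Rightarrow> 'dtm"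
  disp_emp :: "'do"
  disp_ext :: "'o \<times> 'do \<Rightarrow> 'ty \<times> 'dty \<Rightarrow> 'do"
  disp_wk :: "'o \<times> 'do \<Rightarrow> 'ty \<times> 'dty \<Rightarrow> 'dm"
  disp_vz :: "'o \<times> 'do \<Rightarrow> 'ty \<times> 'dty \<Rightarrow> 'dtm"
  disp_pairing :: "'o \<times> 'do \<Rightarrow> 'o \<times> 'do \<Rightarrow> 'ty \<times> 'dty \<Rightarrow> 'm \<times> 'dm \<Rightarrow> 'tm \<times> 'dtm \<Rightarrow> 'dm"
  disp_Pi :: "'o \<times> 'do \<Rightarrow> 'ty \<times> 'dty \<Rightarrow> 'ty \<times> 'dty \<Rightarrow> 'dty"
  disp_lam :: "'o \<times> 'do \<Rightarrow> 'ty \<times> 'dty \<Rightarrow> 'ty \<times> 'dty \<Rightarrow> 'tm \<times> 'dtm \<Rightarrow> 'dtm"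
  disp_app :: "'o \<times> 'do \<Rightarrow> 'ty \<times> 'dty \<Rightarrow> 'ty \<times> 'dty \<Rightarrow> 'tm \<times> 'dtm \<Rightarrow> 'tm \<times> 'dtm \<Rightarrow> 'dtm"

definition total_model :: "('o, 'm, 'ty, 'tm) cwf_pi_data
    \<Rightarrow> ('o, 'm, 'ty, 'tm, 'do, 'dm, 'dty, 'dtm) displayed_data
    \<Rightarrow> ('o \<times> 'do, 'm \<times> 'dm, 'ty \<times> 'dty, 'tm \<times> 'dtm) cwf_pi_data" where
  "total_model M D =
    \<lparr>ob = Sigma (ob M) (disp_ob D),
     hom = \<lambda>X Y. Sigma (hom M (fst X) (fst Y)) (disp_hom D X Y),
     ident = \<lambda>X. (ident M (fst X), disp_ident D X),
     cmp = \<lambda>X Y Z g f. (cmp M (fst X) (fst Y) (fst Z) (fst g) (fst f), disp_comp D X Y Z g f),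
     Ty = \<lambda>X. Sigma (Ty M (fst X)) (disp_Ty D X),
     ty_sub = \<lambda>Y X A f. (ty_sub M (fst Y) (fst X) (fst A) (fst f), disp_ty_sub D Y X A f),
     Tm = \<lambda>X A. Sigma (Tm M (fst X) (fst A)) (disp_Tm D X A),
     tm_sub = \<lambda>Y X A a f.
       (tm_sub M (fst Y) (fst X) (fst A) (fst a) (fst f), disp_tm_sub D Y X A a f),
     emp = (emp M, disp_emp D),
     ext = \<lambda>X A. (ext M (fst X) (fst A), disp_ext D X A),
     wk = \<lambda>X A. (wk M (fst X) (fst A), disp_wk D X A),
     vz = \<lambda>X A. (vz M (fst X) (fst A), disp_vz D X A),
     pairing = \<lambda>Y X A f a.
       (pairing M (fst Y) (fst X) (fst A) (fst f) (fst a), disp_pairing D Y X A f a),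
     PiT = \<lambda>X A B. (PiT M (fst X) (fst A) (fst B), disp_Pi D X A B),
     lam = \<lambda>X A B b. (lam M (fst X) (fst A) (fst B) (fst b), disp_lam D X A B b),
     app = \<lambda>X A B t a. (app M (fst X) (fst A) (fst B) (fst t) (fst a), disp_app D X A B t a)\<rparr>"

definition total_proj ::
  "('o \<times> 'do, 'm \<times> 'dm, 'ty \<times> 'dty, 'tm \<times> 'dtm, 'o, 'm, 'ty, 'tm) cwf_map" where
  "total_proj = \<lparr>on_ob = fst, on_hom = \<lambda>X Y. fst, on_ty = \<lambda>X. fst, on_tm = \<lambda>X A. fst\<rparr>"

definition displayed_model :: "('o, 'm, 'ty, 'tm) cwf_pi_data
    \<Rightarrow> ('o, 'm, 'ty, 'tm, 'do, 'dm, 'dty, 'dtm) displayed_data \<Rightarrow> bool" where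
  "displayed_model M D \<longleftrightarrow> cwf_pi M \<and> cwf_pi (total_model M D)"

definition is_section :: "('o, 'm, 'ty, 'tm) cwf_pi_data
    \<Rightarrow> ('o, 'm, 'ty, 'tm, 'do, 'dm, 'dty, 'dtm) displayed_data
    \<Rightarrow> ('o, 'm, 'ty, 'tm, 'o \<times> 'do, 'm \<times> 'dm, 'ty \<times> 'dty, 'tm \<times> 'dtm) cwf_map \<Rightarrow> bool" where
  "is_section M D F \<longleftrightarrow>
    cwf_pi_morphism M (total_model M D) F \<and> map_eq M (map_comp total_proj F) map_id"

definition admits_section :: "('o, 'm, 'ty, 'tm) cwf_pi_data
    \<Rightarrow> ('o, 'm, 'ty, 'tm, 'do, 'dm, 'dty, 'dtm) displayed_data \<Rightarrow> bool" where
  "admits_section M D \<longleftrightarrow> (\<exists>F. is_section M D F)"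


section \<open>Displayed higher-order models\<close>

text \<open>
  The dependent functions \<open>B\<^sup>\<bullet>\<close> and \<open>b\<^sup>\<bullet>\<close> are elements of extensional dependent products over the
  set \<open>ho_args\<close> of pairs \<open>(a, a\<^sup>\<bullet>)\<close>, so that HOL equality is equality of functions on that set.
  The sets \<open>ho_Ty H A\<close> may overlap, hence the explicit indices.
\<close>

record ('ty, 'tm, 'hty, 'htm) ho_data =
  ho_Ty :: "'ty \<Rightarrow> 'hty set"
  ho_Tm :: "'ty \<Rightarrow> 'hty \<Rightarrow> 'tm \<Rightarrow> 'htm set"
  ho_Pi :: "'ty \<Rightarrow> 'hty \<Rightarrow> 'ty \<Rightarrow> ('tm \<times> 'htm \<Rightarrow> 'hty) \<Rightarrow> 'hty"
  ho_app :: "'ty \<Rightarrow> 'hty \<Rightarrow> 'ty \<Rightarrow> ('tm \<times> 'htm \<Rightarrow> 'hty) \<Rightarrow> 'tm \<Rightarrow> 'htm \<Rightarrow> 'tm \<Rightarrow> 'htm \<Rightarrow> 'htm"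
  ho_lam :: "'ty \<Rightarrow> 'hty \<Rightarrow> 'ty \<Rightarrow> ('tm \<times> 'htm \<Rightarrow> 'hty) \<Rightarrow> 'tm \<Rightarrow> ('tm \<times> 'htm \<Rightarrow> 'htm) \<Rightarrow> 'htm"

definition ho_args :: "('o, 'm, 'ty, 'tm) cwf_pi_data \<Rightarrow> ('ty, 'tm, 'hty, 'htm) ho_data
    \<Rightarrow> 'ty \<Rightarrow> 'hty \<Rightarrow> ('tm \<times> 'htm) set" where
  "ho_args M H A A' = (SIGMA a : Tm M (emp M) A. ho_Tm H A A' a)"

definition ho_ty_fam :: "('o, 'm, 'ty, 'tm) cwf_pi_data \<Rightarrow> ('ty, 'tm, 'hty, 'htm) ho_data
    \<Rightarrow> 'ty \<Rightarrow> 'hty \<Rightarrow> 'ty \<Rightarrow> ('tm \<times> 'htm \<Rightarrow> 'hty) set" where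
  "ho_ty_fam M H A A' B = (\<Pi>\<^sub>E (a, a') \<in> ho_args M H A A'. ho_Ty H (ty_inst M (emp M) A B a))"

definition ho_tm_fam :: "('o, 'm, 'ty, 'tm) cwf_pi_data \<Rightarrow> ('ty, 'tm, 'hty, 'htm) ho_data
    \<Rightarrow> 'ty \<Rightarrow> 'hty \<Rightarrow> 'ty \<Rightarrow> ('tm \<times> 'htm \<Rightarrow> 'hty) \<Rightarrow> 'tm \<Rightarrow> ('tm \<times> 'htm \<Rightarrow> 'htm) set" where
  "ho_tm_fam M H A A' B B' b = (\<Pi>\<^sub>E (a, a') \<in> ho_args M H A A'.
    ho_Tm H (ty_inst M (emp M) A B a) (B' (a, a')) (tm_inst M (emp M) A B b a))"

locale displayed_ho_model = cwf_pi M
  for M :: "('o, 'm, 'ty, 'tm) cwf_pi_data" +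
  fixes H :: "('ty, 'tm, 'hty, 'htm) ho_data"
  assumes ho_Pi_Ty: "\<lbrakk>A \<in> Ty M (emp M); A' \<in> ho_Ty H A; B \<in> Ty M (ext M (emp M) A);
        B' \<in> ho_ty_fam M H A A' B\<rbrakk>
      \<Longrightarrow> ho_Pi H A A' B B' \<in> ho_Ty H (PiT M (emp M) A B)"
    and ho_app_Tm: "\<lbrakk>A \<in> Ty M (emp M); A' \<in> ho_Ty H A; B \<in> Ty M (ext M (emp M) A);
        B' \<in> ho_ty_fam M H A A' B;
        t \<in> Tm M (emp M) (PiT M (emp M) A B);
        t' \<in> ho_Tm H (PiT M (emp M) A B) (ho_Pi H A A' B B') t;
        a \<in> Tm M (emp M) A; a' \<in> ho_Tm H A A' a\<rbrakk>
      \<Longrightarrow> ho_app H A A' B B' t t' a a'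
        \<in> ho_Tm H (ty_inst M (emp M) A B a) (B' (a, a')) (app M (emp M) A B t a)"
    and ho_lam_Tm: "\<lbrakk>A \<in> Ty M (emp M); A' \<in> ho_Ty H A; B \<in> Ty M (ext M (emp M) A);
        B' \<in> ho_ty_fam M H A A' B;
        b \<in> Tm M (ext M (emp M) A) B; b' \<in> ho_tm_fam M H A A' B B' b\<rbrakk>
      \<Longrightarrow> ho_lam H A A' B B' b b'
        \<in> ho_Tm H (PiT M (emp M) A B) (ho_Pi H A A' B B') (lam M (emp M) A B b)"
    and ho_app_lam: "\<lbrakk>A \<in> Ty M (emp M); A' \<in> ho_Ty H A; B \<in> Ty M (ext M (emp M) A);
        B' \<in> ho_ty_fam M H A A' B;
        b \<in> Tm M (ext M (emp M) A) B; b' \<in> ho_tm_fam M H A A' B B' b;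
        a \<in> Tm M (emp M) A; a' \<in> ho_Tm H A A' a\<rbrakk>
      \<Longrightarrow> ho_app H A A' B B' (lam M (emp M) A B b) (ho_lam H A A' B B' b b') a a' = b' (a, a')"
    and ho_lam_app: "\<lbrakk>A \<in> Ty M (emp M); A' \<in> ho_Ty H A; B \<in> Ty M (ext M (emp M) A);
        B' \<in> ho_ty_fam M H A A' B;
        t \<in> Tm M (emp M) (PiT M (emp M) A B);
        t' \<in> ho_Tm H (PiT M (emp M) A B) (ho_Pi H A A' B B') t\<rbrakk>
      \<Longrightarrow> ho_lam H A A' B B' (app_vz M (emp M) A B t)
            (\<lambda>(a, a') \<in> ho_args M H A A'. ho_app H A A' B B' t t' a a') = t'"


section \<open>The scone\<close>

text \<open>
  The displayed contexts of the scone are families of sets.  The elements of these sets are drawn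
  from a type that contains an arbitrary type \<open>'u\<close> and is closed under the unit set and under
  dependent sums with the sets of displayed terms.
\<close>

datatype ('u, 'htm) elem = Atom 'u | Star | Snoc (snoc_init: "('u, 'htm) elem") (snoc_last: 'htm)

type_synonym ('m, 'u, 'htm) scone_ob = "'m \<Rightarrow> ('u, 'htm) elem set"
type_synonym ('m, 'u, 'htm, 'v) scone_fun = "'m \<times> ('u, 'htm) elem \<Rightarrow> 'v"

type_synonym ('o, 'm, 'ty, 'tm, 'hty, 'htm, 'u) scone_data =
  "('o, 'm, 'ty, 'tm,
    ('m, 'u, 'htm) scone_ob,
    ('m, 'u, 'htm, ('u, 'htm) elem) scone_fun,
    ('m, 'u, 'htm, 'hty) scone_fun,
    ('m, 'u, 'htm, 'htm) scone_fun) displayed_data"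

text \<open>The type of \<open>total_model M (scone M H)\<close>.  Each carrier type of \<open>M\<close> is a factor of the
  corresponding carrier type here, and hence injects into it.\<close>

type_synonym ('o, 'm, 'ty, 'tm, 'hty, 'htm, 'u) scone_total_data =
  "('o \<times> ('m, 'u, 'htm) scone_ob,
    'm \<times> ('m, 'u, 'htm, ('u, 'htm) elem) scone_fun,
    'ty \<times> ('m, 'u, 'htm, 'hty) scone_fun,
    'tm \<times> ('m, 'u, 'htm, 'htm) scone_fun) cwf_pi_data"

text \<open>\<open>points M (\<Gamma>, \<Gamma>\<^sup>\<dagger>)\<close> is the set of all \<open>(\<gamma>, \<gamma>\<^sup>\<bullet>)\<close> with \<open>\<gamma> : 1 \<rightarrow> \<Gamma>\<close> and
  \<open>\<gamma>\<^sup>\<bullet> \<in> \<Gamma>\<^sup>\<dagger>(\<gamma>)\<close>.\<close>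

definition points :: "('o, 'm, 'ty, 'tm) cwf_pi_data \<Rightarrow> 'o \<times> ('m, 'u, 'htm) scone_ob
    \<Rightarrow> ('m \<times> ('u, 'htm) elem) set" where
  "points M X = (SIGMA \<gamma> : hom M (emp M) (fst X). snd X \<gamma>)"

text \<open>Every \<open>\<delta> : 1 \<rightarrow> \<Gamma>.A\<close> is \<open>\<langle>\<gamma>, a\<rangle>\<close> for the unique \<open>\<gamma> = p \<circ> \<delta>\<close> and \<open>a = q[\<delta>]\<close>.\<close>

definition scone_ext :: "('o, 'm, 'ty, 'tm) cwf_pi_data \<Rightarrow> ('ty, 'tm, 'hty, 'htm) ho_data
    \<Rightarrow> 'o \<times> ('m, 'u, 'htm) scone_ob \<Rightarrow> 'ty \<times> ('m, 'u, 'htm, 'hty) scone_fun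
    \<Rightarrow> ('m, 'u, 'htm) scone_ob" where
  "scone_ext M H X A =
    (let \<Gamma>A = ext M (fst X) (fst A) in
     (\<lambda>\<delta> \<in> hom M (emp M) \<Gamma>A.
       let \<gamma> = cmp M (emp M) \<Gamma>A (fst X) (wk M (fst X) (fst A)) \<delta>;
            a = tm_sub M (emp M) \<Gamma>A (ty_sub M \<Gamma>A (fst X) (fst A) (wk M (fst X) (fst A)))
                  (vz M (fst X) (fst A)) \<delta>
        in {Snoc x a' | x a'. x \<in> snd X \<gamma> \<and>
              a' \<in> ho_Tm H (ty_sub M (emp M) (fst X) (fst A) \<gamma>) (snd A (\<gamma>, x)) a}))"

text \<open>\<open>scone_under M H X A v (\<gamma>, \<gamma>\<^sup>\<bullet>)\<close> is the function \<open>a\<^sup>\<bullet> \<mapsto> v(\<gamma>\<^sup>\<bullet>, a\<^sup>\<bullet>)\<close>, where \<open>v\<close> is the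
  displayed component of a type or term over \<open>\<Gamma>\<^sup>\<dagger>.A\<^sup>\<dagger>\<close>.\<close>

definition scone_under :: "('o, 'm, 'ty, 'tm) cwf_pi_data \<Rightarrow> ('ty, 'tm, 'hty, 'htm) ho_data
    \<Rightarrow> 'o \<times> ('m, 'u, 'htm) scone_ob \<Rightarrow> 'ty \<times> ('m, 'u, 'htm, 'hty) scone_fun
    \<Rightarrow> ('m, 'u, 'htm, 'v) scone_fun \<Rightarrow> 'm \<times> ('u, 'htm) elem \<Rightarrow> 'tm \<times> 'htm \<Rightarrow> 'v" where
  "scone_under M H X A v =
    (\<lambda>(\<gamma>, x). \<lambda>(a, a') \<in> ho_args M H (ty_sub M (emp M) (fst X) (fst A) \<gamma>) (snd A (\<gamma>, x)).
       v (pairing M (emp M) (fst X) (fst A) \<gamma> a, Snoc x a'))"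

definition scone :: "('o, 'm, 'ty, 'tm) cwf_pi_data \<Rightarrow> ('ty, 'tm, 'hty, 'htm) ho_data
    \<Rightarrow> ('o, 'm, 'ty, 'tm, 'hty, 'htm, 'u) scone_data" where
  "scone M H =
    (let e = emp M in
    \<lparr>disp_ob = \<lambda>\<Gamma>. extensional (hom M e \<Gamma>),
     disp_hom = \<lambda>X Y f. \<Pi>\<^sub>E (\<gamma>, x) \<in> points M X. snd Y (cmp M e (fst X) (fst Y) f \<gamma>),
     disp_ident = \<lambda>X. \<lambda>(\<gamma>, x) \<in> points M X. x,
     disp_comp = \<lambda>X Y Z g f. \<lambda>(\<gamma>, x) \<in> points M X.
       snd g (cmp M e (fst X) (fst Y) (fst f) \<gamma>, snd f (\<gamma>, x)),
     disp_Ty = \<lambda>X A. \<Pi>\<^sub>E (\<gamma>, x) \<in> points M X. ho_Ty H (ty_sub M e (fst X) A \<gamma>),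
     disp_ty_sub = \<lambda>Y X A f. \<lambda>(\<gamma>, x) \<in> points M Y.
       snd A (cmp M e (fst Y) (fst X) (fst f) \<gamma>, snd f (\<gamma>, x)),
     disp_Tm = \<lambda>X A a. \<Pi>\<^sub>E (\<gamma>, x) \<in> points M X.
       ho_Tm H (ty_sub M e (fst X) (fst A) \<gamma>) (snd A (\<gamma>, x)) (tm_sub M e (fst X) (fst A) a \<gamma>),
     disp_tm_sub = \<lambda>Y X A a f. \<lambda>(\<gamma>, x) \<in> points M Y.
       snd a (cmp M e (fst Y) (fst X) (fst f) \<gamma>, snd f (\<gamma>, x)),
     disp_emp = \<lambda>\<gamma> \<in> hom M e e. {Star},
     disp_ext = scone_ext M H,
     disp_wk = \<lambda>X A. \<lambda>(\<delta>, z) \<in> points M (ext M (fst X) (fst A), scone_ext M H X A). snoc_init z,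
     disp_vz = \<lambda>X A. \<lambda>(\<delta>, z) \<in> points M (ext M (fst X) (fst A), scone_ext M H X A). snoc_last z,
     disp_pairing = \<lambda>Y X A f a. \<lambda>(\<gamma>, x) \<in> points M Y. Snoc (snd f (\<gamma>, x)) (snd a (\<gamma>, x)),
     disp_Pi = \<lambda>X A B. \<lambda>(\<gamma>, x) \<in> points M X.
       ho_Pi H (ty_sub M e (fst X) (fst A) \<gamma>) (snd A (\<gamma>, x))
         (ty_lift M e (fst X) (fst A) (fst B) \<gamma>) (scone_under M H X A (snd B) (\<gamma>, x)),
     disp_lam = \<lambda>X A B b. \<lambda>(\<gamma>, x) \<in> points M X.
       ho_lam H (ty_sub M e (fst X) (fst A) \<gamma>) (snd A (\<gamma>, x))
         (ty_lift M e (fst X) (fst A) (fst B) \<gamma>) (scone_under M H X A (snd B) (\<gamma>, x))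
         (tm_lift M e (fst X) (fst A) (fst B) (fst b) \<gamma>) (scone_under M H X A (snd b) (\<gamma>, x)),
     disp_app = \<lambda>X A B t a. \<lambda>(\<gamma>, x) \<in> points M X.
       ho_app H (ty_sub M e (fst X) (fst A) \<gamma>) (snd A (\<gamma>, x))
         (ty_lift M e (fst X) (fst A) (fst B) \<gamma>) (scone_under M H X A (snd B) (\<gamma>, x))
         (tm_sub M e (fst X) (PiT M (fst X) (fst A) (fst B)) (fst t) \<gamma>) (snd t (\<gamma>, x))
         (tm_sub M e (fst X) (fst A) (fst a) \<gamma>) (snd a (\<gamma>, x))\<rparr>)"

end

theory Submission
  imports Defs
begin

text \<open>
  By initiality the total model of the scone receives a morphism \<open>F\<close> from \<open>\<S>\<close>.  Composing \<open>F\<close>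
  with the projection gives an endomorphism of \<open>\<S>\<close>, which is the identity, again by initiality,
  so \<open>F\<close> is a section.  The substance is that the total model of the scone is a model.  A point of
  \<open>\<Gamma>.A\<close> is a pairing \<open>\<langle>\<gamma>, a\<rangle>\<close>, so the operations of the scone at \<open>\<gamma>\<close> only involve
  \<open>A[\<gamma>]\<close>, \<open>B[lift \<gamma>]\<close> and so on over the empty context, where the laws of the displayed
  higher-order model apply.
\<close>

section \<open>Substitution calculus\<close>

context cwf_pi
begin

lemma comp_assoc_right:
  "\<lbrakk>\<Gamma> \<in> ob M; \<Delta> \<in> ob M; \<Theta> \<in> ob M; \<Xi> \<in> ob M; f \<in> hom M \<Gamma> \<Delta>; g \<in> hom M \<Delta> \<Theta>; h \<in> hom M \<Theta> \<Xi>\<rbrakk>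
    \<Longrightarrow> cmp M \<Gamma> \<Delta> \<Xi> (cmp M \<Delta> \<Theta> \<Xi> h g) f = cmp M \<Gamma> \<Theta> \<Xi> h (cmp M \<Gamma> \<Delta> \<Theta> g f)"
  by (simp add: comp_assoc)

lemma ty_sub_sub:
  "\<lbrakk>\<Theta> \<in> ob M; \<Delta> \<in> ob M; \<Gamma> \<in> ob M; A \<in> Ty M \<Gamma>; g \<in> hom M \<Theta> \<Delta>; f \<in> hom M \<Delta> \<Gamma>\<rbrakk>
    \<Longrightarrow> ty_sub M \<Theta> \<Delta> (ty_sub M \<Delta> \<Gamma> A f) g = ty_sub M \<Theta> \<Gamma> A (cmp M \<Theta> \<Delta> \<Gamma> f g)"
  by (simp add: ty_sub_comp)

text \<open>The type of a term is an explicit index, and rewriting may bring it into a form that no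
  longer matches \<open>ty_sub M \<Delta> \<Gamma> A f\<close>. A free \<open>B\<close> constrained
  by an equation lets the rule apply anyway; the later rules with such a premise follow the same
  pattern.\<close>

lemma tm_sub_Tm_eq:
  "\<lbrakk>\<Delta> \<in> ob M; \<Gamma> \<in> ob M; A \<in> Ty M \<Gamma>; a \<in> Tm M \<Gamma> A; f \<in> hom M \<Delta> \<Gamma>; B = ty_sub M \<Delta> \<Gamma> A f\<rbrakk>
    \<Longrightarrow> tm_sub M \<Delta> \<Gamma> A a f \<in> Tm M \<Delta> B"
  by (simp add: tm_sub_Tm)

lemma tm_sub_sub:
  "\<lbrakk>\<Theta> \<in> ob M; \<Delta> \<in> ob M; \<Gamma> \<in> ob M; A \<in> Ty M \<Gamma>; a \<in> Tm M \<Gamma> A; g \<in> hom M \<Theta> \<Delta>; f \<in> hom M \<Delta> \<Gamma>;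
      B = ty_sub M \<Delta> \<Gamma> A f\<rbrakk>
    \<Longrightarrow> tm_sub M \<Theta> \<Delta> B (tm_sub M \<Delta> \<Gamma> A a f) g = tm_sub M \<Theta> \<Gamma> A a (cmp M \<Theta> \<Delta> \<Gamma> f g)"
  by (simp add: tm_sub_comp)

lemma vz_Tm_eq:
  "\<lbrakk>\<Gamma> \<in> ob M; A \<in> Ty M \<Gamma>; B = ty_sub M (ext M \<Gamma> A) \<Gamma> A (wk M \<Gamma> A)\<rbrakk>
    \<Longrightarrow> vz M \<Gamma> A \<in> Tm M (ext M \<Gamma> A) B"
  by (simp add: vz_Tm)

text \<open>By \<open>pairing_eta\<close> a morphism into an extension is determined by its
  composite with \<open>wk\<close> and its substitution into \<open>vz\<close>, so it suffices to
  compute these two.\<close>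

lemma pairing_comp:
  assumes "\<Theta> \<in> ob M" "\<Delta> \<in> ob M" "\<Gamma> \<in> ob M" "A \<in> Ty M \<Gamma>" "f \<in> hom M \<Delta> \<Gamma>"
    "a \<in> Tm M \<Delta> (ty_sub M \<Delta> \<Gamma> A f)" "g \<in> hom M \<Theta> \<Delta>"
  shows "cmp M \<Theta> \<Delta> (ext M \<Gamma> A) (pairing M \<Delta> \<Gamma> A f a) g
    = pairing M \<Theta> \<Gamma> A (cmp M \<Theta> \<Delta> \<Gamma> f g) (tm_sub M \<Theta> \<Delta> (ty_sub M \<Delta> \<Gamma> A f) a g)"
    (is "?h = _")
proof -
  note closed = assms ext_ob wk_hom pairing_hom vz_Tm ty_sub_Ty comp_hom
  have "cmp M \<Theta> (ext M \<Gamma> A) \<Gamma> (wk M \<Gamma> A) ?h = cmp M \<Theta> \<Delta> \<Gamma> f g"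
    by (simp add: comp_assoc wk_pairing closed)
  moreover have "tm_sub M \<Theta> (ext M \<Gamma> A) (ty_sub M (ext M \<Gamma> A) \<Gamma> A (wk M \<Gamma> A)) (vz M \<Gamma> A) ?h
      = tm_sub M \<Theta> \<Delta> (ty_sub M \<Delta> \<Gamma> A f) a g"
    by (simp add: tm_sub_comp vz_pairing wk_pairing closed flip: ty_sub_comp)
  ultimately show ?thesis
    using pairing_eta[of \<Theta> \<Gamma> A ?h] by (simp add: closed)
qed

lemma vz_pairing_eq:
  "\<lbrakk>\<Delta> \<in> ob M; \<Gamma> \<in> ob M; A \<in> Ty M \<Gamma>; f \<in> hom M \<Delta> \<Gamma>; a \<in> Tm M \<Delta> (ty_sub M \<Delta> \<Gamma> A f);
      B = ty_sub M (ext M \<Gamma> A) \<Gamma> A (wk M \<Gamma> A)\<rbrakk>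
    \<Longrightarrow> tm_sub M \<Delta> (ext M \<Gamma> A) B (vz M \<Gamma> A) (pairing M \<Delta> \<Gamma> A f a) = a"
  by (simp add: vz_pairing)

lemma pairing_wk_vz:
  "\<lbrakk>\<Gamma> \<in> ob M; A \<in> Ty M \<Gamma>\<rbrakk>
    \<Longrightarrow> pairing M (ext M \<Gamma> A) \<Gamma> A (wk M \<Gamma> A) (vz M \<Gamma> A) = ident M (ext M \<Gamma> A)"
  using pairing_eta[of "ext M \<Gamma> A" \<Gamma> A "ident M (ext M \<Gamma> A)"]
  by (simp add: ext_ob ident_hom wk_hom vz_Tm comp_ident_right tm_sub_ident ty_sub_Ty)

lemma app_sub_eq:
  "\<lbrakk>\<Delta> \<in> ob M; \<Gamma> \<in> ob M; A \<in> Ty M \<Gamma>; B \<in> Ty M (ext M \<Gamma> A); t \<in> Tm M \<Gamma> (PiT M \<Gamma> A B); a \<in> Tm M \<Gamma> A;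
      f \<in> hom M \<Delta> \<Gamma>; C = ty_inst M \<Gamma> A B a\<rbrakk>
    \<Longrightarrow> tm_sub M \<Delta> \<Gamma> C (app M \<Gamma> A B t a) f
      = app M \<Delta> (ty_sub M \<Delta> \<Gamma> A f) (ty_lift M \<Delta> \<Gamma> A B f)
          (tm_sub M \<Delta> \<Gamma> (PiT M \<Gamma> A B) t f) (tm_sub M \<Delta> \<Gamma> A a f)"
  by (simp add: app_sub)

lemmas closure_simps =
  ident_hom comp_hom ty_sub_Ty tm_sub_Tm_eq emp_ob ext_ob wk_hom vz_Tm_eq pairing_hom PiT_Ty lam_Tm

text \<open>Oriented towards a normal form: composites nest to the right, iterated substitutions
  become one substitution along a composite, and composition with a pairing moves inside it.\<close>

lemmas sub_simps =
  closure_simps comp_ident_left comp_ident_right comp_assoc_right ty_sub_ident ty_sub_sub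
  tm_sub_ident tm_sub_sub wk_pairing vz_pairing_eq pairing_eta pairing_wk_vz pairing_comp

section \<open>Instantiation and lifting\<close>

lemma inst_hom:
  "\<lbrakk>\<Gamma> \<in> ob M; A \<in> Ty M \<Gamma>; a \<in> Tm M \<Gamma> A\<rbrakk> \<Longrightarrow> inst M \<Gamma> A a \<in> hom M \<Gamma> (ext M \<Gamma> A)"
  by (simp add: inst_def sub_simps)

lemma inst_comp:
  "\<lbrakk>\<Delta> \<in> ob M; \<Gamma> \<in> ob M; A \<in> Ty M \<Gamma>; a \<in> Tm M \<Gamma> A; f \<in> hom M \<Delta> \<Gamma>\<rbrakk>
    \<Longrightarrow> cmp M \<Delta> \<Gamma> (ext M \<Gamma> A) (inst M \<Gamma> A a) f = pairing M \<Delta> \<Gamma> A f (tm_sub M \<Delta> \<Gamma> A a f)"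
  by (simp add: inst_def sub_simps)

lemma lift_hom:
  "\<lbrakk>\<Delta> \<in> ob M; \<Gamma> \<in> ob M; A \<in> Ty M \<Gamma>; f \<in> hom M \<Delta> \<Gamma>\<rbrakk>
    \<Longrightarrow> lift M \<Delta> \<Gamma> A f \<in> hom M (ext M \<Delta> (ty_sub M \<Delta> \<Gamma> A f)) (ext M \<Gamma> A)"
  by (simp add: lift_def Let_def sub_simps)

text \<open>This computes where \<open>lift\<close> sends a point of an extension, which is how the
  scone sees substitution under a binder.\<close>

lemma lift_pairing:
  "\<lbrakk>\<Theta> \<in> ob M; \<Delta> \<in> ob M; \<Gamma> \<in> ob M; A \<in> Ty M \<Gamma>; f \<in> hom M \<Delta> \<Gamma>; g \<in> hom M \<Theta> \<Delta>;
      a \<in> Tm M \<Theta> (ty_sub M \<Theta> \<Gamma> A (cmp M \<Theta> \<Delta> \<Gamma> f g)); A' = ty_sub M \<Delta> \<Gamma> A f\<rbrakk>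
    \<Longrightarrow> cmp M \<Theta> (ext M \<Delta> A') (ext M \<Gamma> A) (lift M \<Delta> \<Gamma> A f) (pairing M \<Theta> \<Delta> A' g a)
      = pairing M \<Theta> \<Gamma> A (cmp M \<Theta> \<Delta> \<Gamma> f g) a"
  by (simp add: lift_def Let_def sub_simps)

lemma lift_lift:
  "\<lbrakk>\<Theta> \<in> ob M; \<Delta> \<in> ob M; \<Gamma> \<in> ob M; A \<in> Ty M \<Gamma>; f \<in> hom M \<Delta> \<Gamma>; g \<in> hom M \<Theta> \<Delta>\<rbrakk>
    \<Longrightarrow> cmp M (ext M \<Theta> (ty_sub M \<Theta> \<Gamma> A (cmp M \<Theta> \<Delta> \<Gamma> f g))) (ext M \<Delta> (ty_sub M \<Delta> \<Gamma> A f)) (ext M \<Gamma> A)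
          (lift M \<Delta> \<Gamma> A f) (lift M \<Theta> \<Delta> (ty_sub M \<Delta> \<Gamma> A f) g)
      = lift M \<Theta> \<Gamma> A (cmp M \<Theta> \<Delta> \<Gamma> f g)"
  by (simp add: lift_def Let_def sub_simps)

lemma ty_lift_Ty:
  "\<lbrakk>\<Delta> \<in> ob M; \<Gamma> \<in> ob M; A \<in> Ty M \<Gamma>; B \<in> Ty M (ext M \<Gamma> A); f \<in> hom M \<Delta> \<Gamma>\<rbrakk>
    \<Longrightarrow> ty_lift M \<Delta> \<Gamma> A B f \<in> Ty M (ext M \<Delta> (ty_sub M \<Delta> \<Gamma> A f))"
  by (simp add: ty_lift_def closure_simps lift_hom)

lemma tm_lift_Tm:
  "\<lbrakk>\<Delta> \<in> ob M; \<Gamma> \<in> ob M; A \<in> Ty M \<Gamma>; B \<in> Ty M (ext M \<Gamma> A); b \<in> Tm M (ext M \<Gamma> A) B; f \<in> hom M \<Delta> \<Gamma>\<rbrakk>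
    \<Longrightarrow> tm_lift M \<Delta> \<Gamma> A B b f
      \<in> Tm M (ext M \<Delta> (ty_sub M \<Delta> \<Gamma> A f)) (ty_lift M \<Delta> \<Gamma> A B f)"
  by (simp add: tm_lift_def ty_lift_def closure_simps lift_hom)

lemma ty_lift_lift:
  "\<lbrakk>\<Theta> \<in> ob M; \<Delta> \<in> ob M; \<Gamma> \<in> ob M; A \<in> Ty M \<Gamma>; B \<in> Ty M (ext M \<Gamma> A);
      f \<in> hom M \<Delta> \<Gamma>; g \<in> hom M \<Theta> \<Delta>; A' = ty_sub M \<Delta> \<Gamma> A f\<rbrakk>
    \<Longrightarrow> ty_lift M \<Theta> \<Delta> A' (ty_lift M \<Delta> \<Gamma> A B f) g = ty_lift M \<Theta> \<Gamma> A B (cmp M \<Theta> \<Delta> \<Gamma> f g)"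
  using lift_hom[of \<Theta> \<Delta> A' g]
  by (simp add: ty_lift_def sub_simps lift_hom lift_lift)

lemma tm_lift_lift:
  "\<lbrakk>\<Theta> \<in> ob M; \<Delta> \<in> ob M; \<Gamma> \<in> ob M; A \<in> Ty M \<Gamma>; B \<in> Ty M (ext M \<Gamma> A); b \<in> Tm M (ext M \<Gamma> A) B;
      f \<in> hom M \<Delta> \<Gamma>; g \<in> hom M \<Theta> \<Delta>; A' = ty_sub M \<Delta> \<Gamma> A f; B' = ty_lift M \<Delta> \<Gamma> A B f\<rbrakk>
    \<Longrightarrow> tm_lift M \<Theta> \<Delta> A' B' (tm_lift M \<Delta> \<Gamma> A B b f) g
      = tm_lift M \<Theta> \<Gamma> A B b (cmp M \<Theta> \<Delta> \<Gamma> f g)"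
  using lift_hom[of \<Theta> \<Delta> A' g]
  by (simp add: tm_lift_def ty_lift_def sub_simps lift_hom lift_lift)

text \<open>Composing the lift with \<open>\<langle>id, a\<rangle>\<close> leaves the pairing
  \<open>\<langle>f, a\<rangle>\<close>. With the empty context as \<open>\<Delta>\<close> this
  reconciles two views of a fibre: the higher-order model instantiates \<open>B\<close> lifted along
  \<gamma>, the scone evaluates \<open>B\<close> at the point
  \<open>\<langle>\<gamma>, a\<rangle>\<close>.\<close>

lemma ty_inst_lift:
  "\<lbrakk>\<Delta> \<in> ob M; \<Gamma> \<in> ob M; A \<in> Ty M \<Gamma>; B \<in> Ty M (ext M \<Gamma> A); f \<in> hom M \<Delta> \<Gamma>;
      a \<in> Tm M \<Delta> (ty_sub M \<Delta> \<Gamma> A f)\<rbrakk>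
    \<Longrightarrow> ty_inst M \<Delta> (ty_sub M \<Delta> \<Gamma> A f) (ty_lift M \<Delta> \<Gamma> A B f) a
      = ty_sub M \<Delta> (ext M \<Gamma> A) B (pairing M \<Delta> \<Gamma> A f a)"
  by (simp add: ty_inst_def inst_def ty_lift_def sub_simps lift_hom lift_pairing)

lemma tm_inst_lift:
  "\<lbrakk>\<Delta> \<in> ob M; \<Gamma> \<in> ob M; A \<in> Ty M \<Gamma>; B \<in> Ty M (ext M \<Gamma> A); b \<in> Tm M (ext M \<Gamma> A) B; f \<in> hom M \<Delta> \<Gamma>;
      a \<in> Tm M \<Delta> (ty_sub M \<Delta> \<Gamma> A f)\<rbrakk>
    \<Longrightarrow> tm_inst M \<Delta> (ty_sub M \<Delta> \<Gamma> A f) (ty_lift M \<Delta> \<Gamma> A B f) (tm_lift M \<Delta> \<Gamma> A B b f) a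
      = tm_sub M \<Delta> (ext M \<Gamma> A) B b (pairing M \<Delta> \<Gamma> A f a)"
  by (simp add: tm_inst_def inst_def ty_lift_def tm_lift_def sub_simps lift_hom lift_pairing)

lemma ty_inst_sub:
  "\<lbrakk>\<Delta> \<in> ob M; \<Gamma> \<in> ob M; A \<in> Ty M \<Gamma>; B \<in> Ty M (ext M \<Gamma> A); a \<in> Tm M \<Gamma> A; f \<in> hom M \<Delta> \<Gamma>\<rbrakk>
    \<Longrightarrow> ty_sub M \<Delta> \<Gamma> (ty_inst M \<Gamma> A B a) f
      = ty_sub M \<Delta> (ext M \<Gamma> A) B (pairing M \<Delta> \<Gamma> A f (tm_sub M \<Delta> \<Gamma> A a f))"
  by (simp add: ty_inst_def inst_comp inst_hom ty_sub_sub ext_ob)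

text \<open>Prepares \<eta>: \<open>ho_lam_app\<close> mentions \<open>app_vz\<close> over the empty
  context, whereas \<open>lam\<close> in the scone supplies a lifted body. Both sides reduce to an
  application to \<open>vz\<close> whose other data are substituted along
  \<open>f \<circ> p\<close>.\<close>

lemma app_vz_sub:
  assumes "\<Delta> \<in> ob M" "\<Gamma> \<in> ob M" "A \<in> Ty M \<Gamma>" "B \<in> Ty M (ext M \<Gamma> A)" "t \<in> Tm M \<Gamma> (PiT M \<Gamma> A B)"
    "f \<in> hom M \<Delta> \<Gamma>"
  shows "tm_lift M \<Delta> \<Gamma> A B (app_vz M \<Gamma> A B t) f
    = app_vz M \<Delta> (ty_sub M \<Delta> \<Gamma> A f) (ty_lift M \<Delta> \<Gamma> A B f)
        (tm_sub M \<Delta> \<Gamma> (PiT M \<Gamma> A B) t f)"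
proof -
  let ?A = "ty_sub M \<Delta> \<Gamma> A f"
  let ?E = "ext M \<Delta> ?A"
  have l: "lift M \<Delta> \<Gamma> A f \<in> hom M ?E (ext M \<Gamma> A)"
    using assms by (simp add: lift_hom)
  have wk: "cmp M ?E (ext M \<Gamma> A) \<Gamma> (wk M \<Gamma> A) (lift M \<Delta> \<Gamma> A f) = cmp M ?E \<Delta> \<Gamma> f (wk M \<Delta> ?A)"
    using assms by (simp add: lift_def Let_def sub_simps)
  have vz: "tm_sub M ?E (ext M \<Gamma> A) (ty_sub M (ext M \<Gamma> A) \<Gamma> A (wk M \<Gamma> A)) (vz M \<Gamma> A)
      (lift M \<Delta> \<Gamma> A f) = vz M \<Delta> ?A"
    using assms by (simp add: lift_def Let_def sub_simps)
  have "tm_lift M \<Delta> \<Gamma> A B (app_vz M \<Gamma> A B t) f =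
    tm_sub M ?E (ext M \<Gamma> A) B (app_vz M \<Gamma> A B t) (lift M \<Delta> \<Gamma> A f)"
    by (simp add: tm_lift_def)
  also have "\<dots> = app M ?E (ty_sub M ?E \<Gamma> A (cmp M ?E \<Delta> \<Gamma> f (wk M \<Delta> ?A)))
     (ty_lift M ?E \<Gamma> A B (cmp M ?E \<Delta> \<Gamma> f (wk M \<Delta> ?A)))
     (tm_sub M ?E \<Gamma> (PiT M \<Gamma> A B) t (cmp M ?E \<Delta> \<Gamma> f (wk M \<Delta> ?A))) (vz M \<Delta> ?A)"
    unfolding app_vz_def
    by (subst app_sub_eq)
      (simp_all add: assms l wk vz sub_simps PiT_sub ty_lift_Ty ty_inst_lift ty_lift_lift)
  \<comment> \<open>Here \<open>PiT_sub\<close> is used from right to left, so that the type index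
    of the substituted function is again a substitution instance and its two substitutions
    fuse.\<close>
  also have "\<dots> = app_vz M \<Delta> ?A (ty_lift M \<Delta> \<Gamma> A B f) (tm_sub M \<Delta> \<Gamma> (PiT M \<Gamma> A B) t f)"
    unfolding app_vz_def
    by (simp add: assms sub_simps ty_lift_lift flip: PiT_sub)
  finally show ?thesis .
qed

end


section \<open>Total models and initiality\<close>

lemma total_model_fst:
  "fst (ident (total_model M D) X) = ident M (fst X)"
  "fst (cmp (total_model M D) X Y Z g f) = cmp M (fst X) (fst Y) (fst Z) (fst g) (fst f)"
  "fst (ty_sub (total_model M D) Y X A f) = ty_sub M (fst Y) (fst X) (fst A) (fst f)"
  "fst (tm_sub (total_model M D) Y X A a f) = tm_sub M (fst Y) (fst X) (fst A) (fst a) (fst f)"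
  "fst (emp (total_model M D)) = emp M"
  "fst (ext (total_model M D) X A) = ext M (fst X) (fst A)"
  "fst (wk (total_model M D) X A) = wk M (fst X) (fst A)"
  "fst (vz (total_model M D) X A) = vz M (fst X) (fst A)"
  "fst (pairing (total_model M D) Y X A f a) = pairing M (fst Y) (fst X) (fst A) (fst f) (fst a)"
  "fst (PiT (total_model M D) X A B) = PiT M (fst X) (fst A) (fst B)"
  "fst (lam (total_model M D) X A B b) = lam M (fst X) (fst A) (fst B) (fst b)"
  "fst (app (total_model M D) X A B t a) = app M (fst X) (fst A) (fst B) (fst t) (fst a)"
  by (simp_all add: total_model_def)

lemma total_model_fst_derived:
  "fst (inst (total_model M D) X A a) = inst M (fst X) (fst A) (fst a)"
  "fst (lift (total_model M D) Y X A f) = lift M (fst Y) (fst X) (fst A) (fst f)"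
  "fst (ty_inst (total_model M D) X A B a) = ty_inst M (fst X) (fst A) (fst B) (fst a)"
  "fst (tm_inst (total_model M D) X A B b a) = tm_inst M (fst X) (fst A) (fst B) (fst b) (fst a)"
  "fst (ty_lift (total_model M D) Y X A B f) = ty_lift M (fst Y) (fst X) (fst A) (fst B) (fst f)"
  "fst (tm_lift (total_model M D) Y X A B b f)
    = tm_lift M (fst Y) (fst X) (fst A) (fst B) (fst b) (fst f)"
  "fst (app_vz (total_model M D) X A B t) = app_vz M (fst X) (fst A) (fst B) (fst t)"
  by (simp_all add: inst_def lift_def ty_inst_def tm_inst_def ty_lift_def tm_lift_def app_vz_def
      total_model_fst Let_def)

lemma total_model_mem:
  "X \<in> ob (total_model M D) \<longleftrightarrow> fst X \<in> ob M \<and> snd X \<in> disp_ob D (fst X)"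
  "f \<in> hom (total_model M D) X Y \<longleftrightarrow> fst f \<in> hom M (fst X) (fst Y) \<and> snd f \<in> disp_hom D X Y (fst f)"
  "A \<in> Ty (total_model M D) X \<longleftrightarrow> fst A \<in> Ty M (fst X) \<and> snd A \<in> disp_Ty D X (fst A)"
  "a \<in> Tm (total_model M D) X A \<longleftrightarrow> fst a \<in> Tm M (fst X) (fst A) \<and> snd a \<in> disp_Tm D X A (fst a)"
proof -
  have Sigma_iff: "p \<in> Sigma A B \<longleftrightarrow> fst p \<in> A \<and> snd p \<in> B (fst p)"
    for p :: "'x \<times> 'y" and A B
    by (cases p) simp
  show
    "X \<in> ob (total_model M D) \<longleftrightarrow> fst X \<in> ob M \<and> snd X \<in> disp_ob D (fst X)"
    "f \<in> hom (total_model M D) X Y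
      \<longleftrightarrow> fst f \<in> hom M (fst X) (fst Y) \<and> snd f \<in> disp_hom D X Y (fst f)"
    "A \<in> Ty (total_model M D) X \<longleftrightarrow> fst A \<in> Ty M (fst X) \<and> snd A \<in> disp_Ty D X (fst A)"
    "a \<in> Tm (total_model M D) X A \<longleftrightarrow> fst a \<in> Tm M (fst X) (fst A) \<and> snd a \<in> disp_Tm D X A (fst a)"
    by (simp_all add: total_model_def Sigma_iff)
qed

text \<open>The total model of \<open>trivial_displayed\<close> is a copy of \<open>M\<close> on larger carrier types.  It is needed
  because initiality speaks only about models on the carrier types of the total model of the scone,
  and not about \<open>\<S>\<close> itself.\<close>

definition trivial_displayed :: "('o, 'm, 'ty, 'tm, 'do, 'dm, 'dty, 'dtm) displayed_data" where
  "trivial_displayed =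
    \<lparr>disp_ob = \<lambda>_. {undefined},
     disp_hom = \<lambda>_ _ _. {undefined},
     disp_ident = \<lambda>_. undefined,
     disp_comp = \<lambda>_ _ _ _ _. undefined,
     disp_Ty = \<lambda>_ _. {undefined},
     disp_ty_sub = \<lambda>_ _ _ _. undefined,
     disp_Tm = \<lambda>_ _ _. {undefined},
     disp_tm_sub = \<lambda>_ _ _ _ _. undefined,
     disp_emp = undefined,
     disp_ext = \<lambda>_ _. undefined,
     disp_wk = \<lambda>_ _. undefined,
     disp_vz = \<lambda>_ _. undefined,
     disp_pairing = \<lambda>_ _ _ _ _. undefined,
     disp_Pi = \<lambda>_ _ _. undefined,
     disp_lam = \<lambda>_ _ _ _. undefined,
     disp_app = \<lambda>_ _ _ _ _. undefined\<rparr>"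

lemma trivial_displayed_snd:
  "snd (ident (total_model M trivial_displayed) X) = undefined"
  "snd (cmp (total_model M trivial_displayed) X Y Z g f) = undefined"
  "snd (ty_sub (total_model M trivial_displayed) Y X A f) = undefined"
  "snd (tm_sub (total_model M trivial_displayed) Y X A a f) = undefined"
  "snd (emp (total_model M trivial_displayed)) = undefined"
  "snd (ext (total_model M trivial_displayed) X A) = undefined"
  "snd (wk (total_model M trivial_displayed) X A) = undefined"
  "snd (vz (total_model M trivial_displayed) X A) = undefined"
  "snd (pairing (total_model M trivial_displayed) Y X A f a) = undefined"
  "snd (PiT (total_model M trivial_displayed) X A B) = undefined"
  "snd (lam (total_model M trivial_displayed) X A B b) = undefined"
  "snd (app (total_model M trivial_displayed) X A B t a) = undefined"
  "snd (tm_inst (total_model M trivial_displayed) X A B b a) = undefined"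
  by (simp_all add: total_model_def trivial_displayed_def tm_inst_def)

lemma trivial_displayed_mem:
  "x \<in> disp_ob trivial_displayed \<Gamma> \<longleftrightarrow> x = undefined"
  "x \<in> disp_hom trivial_displayed X Y f \<longleftrightarrow> x = undefined"
  "x \<in> disp_Ty trivial_displayed X A \<longleftrightarrow> x = undefined"
  "x \<in> disp_Tm trivial_displayed X A' a \<longleftrightarrow> x = undefined"
  by (simp_all add: trivial_displayed_def)

text \<open>Every displayed set is the singleton of \<open>undefined\<close>, so each axiom is
  trivial in the second component and is the same axiom of \<open>M\<close> in the first.\<close>

lemma (in cwf_pi) cwf_pi_total_trivial: "cwf_pi (total_model M trivial_displayed)"
proof -
  have ex1: "\<exists>!f. f \<in> hom (total_model M trivial_displayed) X (emp (total_model M trivial_displayed))"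
    if "X \<in> ob (total_model M trivial_displayed)" for X
  proof -
    from that have "fst X \<in> ob M"
      by (simp add: total_model_mem)
    from emp_terminal[OF this] obtain u
      where u: "u \<in> hom M (fst X) (emp M)" "\<And>f. f \<in> hom M (fst X) (emp M) \<Longrightarrow> f = u"
      by (elim ex1E) blast
    show ?thesis
    proof (rule ex1I[of _ "(u, undefined)"])
      show "(u, undefined) \<in> hom (total_model M trivial_displayed) X (emp (total_model M trivial_displayed))"
        using u(1) by (simp add: total_model_mem total_model_fst trivial_displayed_mem)
    next
      fix f assume "f \<in> hom (total_model M trivial_displayed) X (emp (total_model M trivial_displayed))"
      then have "fst f \<in> hom M (fst X) (emp M)" "snd f = undefined"
        by (simp_all add: total_model_mem total_model_fst trivial_displayed_mem)
      then show "f = (u, undefined)"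
        using u(2)[of "fst f"] by (simp add: prod_eq_iff)
    qed
  qed
  show ?thesis
    by (unfold_locales; (rule ex1, assumption)?;
      (simp add: total_model_mem total_model_fst total_model_fst_derived prod_eq_iff
        trivial_displayed_snd trivial_displayed_mem)?;
      (elim conjE)?;
      (rule ident_hom comp_hom comp_ident_left comp_ident_right comp_assoc ty_sub_Ty ty_sub_ident
        ty_sub_comp tm_sub_Tm tm_sub_ident tm_sub_comp emp_ob ext_ob wk_hom vz_Tm pairing_hom
        wk_pairing vz_pairing pairing_eta PiT_Ty PiT_sub lam_Tm lam_sub app_Tm app_sub app_lam lam_app;
        assumption)?)
qed

lemma cwf_pi_morphism_id: "cwf_pi_morphism M M map_id"
  by unfold_locales (simp_all add: map_id_def)

text \<open>Padding by \<open>undefined\<close> moves a morphism to the carrier types for which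
  initiality is available.\<close>

lemma cwf_pi_morphism_total_trivial:
  assumes "cwf_pi_morphism M N F"
  shows "cwf_pi_morphism M (total_model N trivial_displayed)
    \<lparr>on_ob = \<lambda>\<Gamma>. (on_ob F \<Gamma>, undefined), on_hom = \<lambda>\<Gamma> \<Delta> f. (on_hom F \<Gamma> \<Delta> f, undefined),
     on_ty = \<lambda>\<Gamma> A. (on_ty F \<Gamma> A, undefined), on_tm = \<lambda>\<Gamma> A a. (on_tm F \<Gamma> A a, undefined)\<rparr>"
  using assms
  by (simp add: cwf_pi_morphism_def total_model_def trivial_displayed_def)

lemma cwf_pi_morphism_proj:
  assumes "cwf_pi_morphism M (total_model N D) F"
  shows "cwf_pi_morphism M N (map_comp total_proj F)"
  using assms
  by (simp add: cwf_pi_morphism_def total_model_mem total_model_fst map_comp_def total_proj_def)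

text \<open>The padded \<open>G\<close> and the padded identity are both morphisms into the padded
  copy of \<open>S\<close>, so the unique morphism \<open>F\<close> agrees with each of them;
  comparing first components gives the claim.\<close>

lemma initial_model_endo:
  fixes S :: "('o, 'm, 'ty, 'tm) cwf_pi_data"
  assumes "initial_model TYPE(('o \<times> 'do, 'm \<times> 'dm, 'ty \<times> 'dty, 'tm \<times> 'dtm) cwf_pi_data) S"
    and "cwf_pi_morphism S S G"
  shows "map_eq S G map_id"
proof -
  let ?N = "total_model S (trivial_displayed ::
    ('o, 'm, 'ty, 'tm, 'do, 'dm, 'dty, 'dtm) displayed_data)"
  have "cwf_pi ?N"
    using assms(1) cwf_pi.cwf_pi_total_trivial by (auto simp: initial_model_def)
  then obtain F where F: "\<And>G. cwf_pi_morphism S ?N G \<Longrightarrow> map_eq S F G"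
    using assms(1) by (auto simp: initial_model_def)
  show ?thesis
    using F[OF cwf_pi_morphism_total_trivial[OF assms(2)]]
      F[OF cwf_pi_morphism_total_trivial[OF cwf_pi_morphism_id]]
    by (simp add: map_eq_def map_id_def)
qed

section \<open>The scone\<close>

lemma mem_points_iff [simp]: "(\<gamma>, x) \<in> points M X \<longleftrightarrow> \<gamma> \<in> hom M (emp M) (fst X) \<and> x \<in> snd X \<gamma>"
  by (simp add: points_def)

lemma PiE_points_iff:
  "f \<in> (\<Pi>\<^sub>E (\<gamma>, x) \<in> points M X. V \<gamma> x) \<longleftrightarrow>
    f \<in> extensional (points M X) \<and> (\<forall>\<gamma> \<in> hom M (emp M) (fst X). \<forall>x \<in> snd X \<gamma>. f (\<gamma>, x) \<in> V \<gamma> x)"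
  by (auto simp: PiE_def points_def)

lemma restrict_points_cong:
  assumes "\<And>\<gamma> x. \<lbrakk>\<gamma> \<in> hom M (emp M) (fst X); x \<in> snd X \<gamma>\<rbrakk> \<Longrightarrow> f (\<gamma>, x) = g (\<gamma>, x)"
  shows "restrict f (points M X) = restrict g (points M X)"
  using assms by (auto simp: points_def intro!: restrict_ext)

text \<open>For laws whose right side is a given displayed component: off the points it is
  \<open>undefined\<close> by extensionality, so agreement on points suffices. Laws between two
  computed components use \<open>restrict_points_cong\<close>.\<close>

lemma restrict_points_eqI:
  assumes "g \<in> extensional (points M X)"
    and "\<And>\<gamma> x. \<lbrakk>\<gamma> \<in> hom M (emp M) (fst X); x \<in> snd X \<gamma>\<rbrakk> \<Longrightarrow> f (\<gamma>, x) = g (\<gamma>, x)"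
  shows "restrict f (points M X) = g"
  using restrict_points_cong[of M X f g] assms by (simp add: extensional_restrict)

section \<open>Components of and membership in the total model\<close>

definition scone_total :: "('o, 'm, 'ty, 'tm) cwf_pi_data \<Rightarrow> ('ty, 'tm, 'hty, 'htm) ho_data
    \<Rightarrow> ('o, 'm, 'ty, 'tm, 'hty, 'htm, 'u) scone_total_data" where
  "scone_total M H = total_model M (scone M H)"

lemmas scone_fst = total_model_fst[of M "scone M H" for M H, folded scone_total_def]
lemmas scone_fst_derived = total_model_fst_derived[of M "scone M H" for M H, folded scone_total_def]

lemma scone_mem:
  "X \<in> ob (scone_total M H) \<longleftrightarrow> fst X \<in> ob M \<and> snd X \<in> extensional (hom M (emp M) (fst X))"
  "f \<in> hom (scone_total M H) X Y \<longleftrightarrow> fst f \<in> hom M (fst X) (fst Y) \<and>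
    snd f \<in> extensional (points M X) \<and>
    (\<forall>\<gamma> \<in> hom M (emp M) (fst X). \<forall>x \<in> snd X \<gamma>.
      snd f (\<gamma>, x) \<in> snd Y (cmp M (emp M) (fst X) (fst Y) (fst f) \<gamma>))"
  "A \<in> Ty (scone_total M H) X \<longleftrightarrow> fst A \<in> Ty M (fst X) \<and>
    snd A \<in> extensional (points M X) \<and>
    (\<forall>\<gamma> \<in> hom M (emp M) (fst X). \<forall>x \<in> snd X \<gamma>.
      snd A (\<gamma>, x) \<in> ho_Ty H (ty_sub M (emp M) (fst X) (fst A) \<gamma>))"
  "a \<in> Tm (scone_total M H) X A \<longleftrightarrow> fst a \<in> Tm M (fst X) (fst A) \<and>
    snd a \<in> extensional (points M X) \<and>
    (\<forall>\<gamma> \<in> hom M (emp M) (fst X). \<forall>x \<in> snd X \<gamma>.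
      snd a (\<gamma>, x) \<in> ho_Tm H (ty_sub M (emp M) (fst X) (fst A) \<gamma>) (snd A (\<gamma>, x))
        (tm_sub M (emp M) (fst X) (fst A) (fst a) \<gamma>))"
  by (simp_all add: scone_total_def total_model_mem scone_def Let_def PiE_points_iff)

lemma scone_ext_eq:
  "ext (scone_total M H) X A = (ext M (fst X) (fst A), scone_ext M H X A)"
  by (simp add: scone_total_def total_model_def scone_def Let_def)

lemma scone_snd:
  "snd (ident (scone_total M H) X) = (\<lambda>(\<gamma>, x) \<in> points M X. x)"
  "snd (cmp (scone_total M H) X Y Z g f) = (\<lambda>(\<gamma>, x) \<in> points M X.
    snd g (cmp M (emp M) (fst X) (fst Y) (fst f) \<gamma>, snd f (\<gamma>, x)))"
  "snd (ty_sub (scone_total M H) Y X A f) = (\<lambda>(\<gamma>, x) \<in> points M Y.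
    snd A (cmp M (emp M) (fst Y) (fst X) (fst f) \<gamma>, snd f (\<gamma>, x)))"
  "snd (tm_sub (scone_total M H) Y X A a f) = (\<lambda>(\<gamma>, x) \<in> points M Y.
    snd a (cmp M (emp M) (fst Y) (fst X) (fst f) \<gamma>, snd f (\<gamma>, x)))"
  "snd (emp (scone_total M H)) = (\<lambda>\<gamma> \<in> hom M (emp M) (emp M). {Star})"
  "snd (ext (scone_total M H) X A) = scone_ext M H X A"
  "snd (wk (scone_total M H) X A)
    = (\<lambda>(\<delta>, z) \<in> points M (ext (scone_total M H) X A). snoc_init z)"
  "snd (vz (scone_total M H) X A)
    = (\<lambda>(\<delta>, z) \<in> points M (ext (scone_total M H) X A). snoc_last z)"
  "snd (pairing (scone_total M H) Y X A f a)
    = (\<lambda>(\<gamma>, x) \<in> points M Y. Snoc (snd f (\<gamma>, x)) (snd a (\<gamma>, x)))"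
  "snd (PiT (scone_total M H) X A B) = (\<lambda>(\<gamma>, x) \<in> points M X.
    ho_Pi H (ty_sub M (emp M) (fst X) (fst A) \<gamma>) (snd A (\<gamma>, x))
      (ty_lift M (emp M) (fst X) (fst A) (fst B) \<gamma>) (scone_under M H X A (snd B) (\<gamma>, x)))"
  "snd (lam (scone_total M H) X A B b) = (\<lambda>(\<gamma>, x) \<in> points M X.
    ho_lam H (ty_sub M (emp M) (fst X) (fst A) \<gamma>) (snd A (\<gamma>, x))
      (ty_lift M (emp M) (fst X) (fst A) (fst B) \<gamma>) (scone_under M H X A (snd B) (\<gamma>, x))
      (tm_lift M (emp M) (fst X) (fst A) (fst B) (fst b) \<gamma>) (scone_under M H X A (snd b) (\<gamma>, x)))"
  "snd (app (scone_total M H) X A B t a) = (\<lambda>(\<gamma>, x) \<in> points M X.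
    ho_app H (ty_sub M (emp M) (fst X) (fst A) \<gamma>) (snd A (\<gamma>, x))
      (ty_lift M (emp M) (fst X) (fst A) (fst B) \<gamma>) (scone_under M H X A (snd B) (\<gamma>, x))
      (tm_sub M (emp M) (fst X) (PiT M (fst X) (fst A) (fst B)) (fst t) \<gamma>) (snd t (\<gamma>, x))
      (tm_sub M (emp M) (fst X) (fst A) (fst a) \<gamma>) (snd a (\<gamma>, x)))"
  by (simp_all add: scone_total_def total_model_def scone_def Let_def)

context displayed_ho_model
begin

section \<open>Points of a context extension and functions under a binder\<close>

lemma mem_scone_ext:
  assumes "\<delta> \<in> hom M (emp M) (ext M (fst X) (fst A))"
  shows "z \<in> scone_ext M H X A \<delta> \<longleftrightarrow>
    (\<exists>x a'. z = Snoc x a' \<and> x \<in> snd X (cmp M (emp M) (ext M (fst X) (fst A)) (fst X) (wk M (fst X) (fst A)) \<delta>)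
      \<and> a' \<in> ho_Tm H
          (ty_sub M (emp M) (fst X) (fst A)
            (cmp M (emp M) (ext M (fst X) (fst A)) (fst X) (wk M (fst X) (fst A)) \<delta>))
          (snd A (cmp M (emp M) (ext M (fst X) (fst A)) (fst X) (wk M (fst X) (fst A)) \<delta>, x))
          (tm_sub M (emp M) (ext M (fst X) (fst A))
            (ty_sub M (ext M (fst X) (fst A)) (fst X) (fst A) (wk M (fst X) (fst A)))
            (vz M (fst X) (fst A)) \<delta>))"
  using assms by (simp add: scone_ext_def Let_def)

text \<open>The projections of \<open>\<langle>\<gamma>, a\<rangle>\<close> are \<gamma> and
  \<open>a\<close>, which turns the encoding by \<open>p\<close> and \<open>q\<close> into the
  dependent sum of the scone. The equations for \<open>\<Gamma>\<close> and \<open>A\<^sub>0\<close>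
  let the rule match after \<open>fst X\<close> and \<open>fst A\<close> have been simplified inside
  the pairing.\<close>

lemma Snoc_mem_scone_ext:
  assumes "fst X \<in> ob M" "fst A \<in> Ty M (fst X)" "\<gamma> \<in> hom M (emp M) (fst X)"
    "a \<in> Tm M (emp M) (ty_sub M (emp M) (fst X) (fst A) \<gamma>)" "\<Gamma> = fst X" "A\<^sub>0 = fst A"
  shows "Snoc x a' \<in> scone_ext M H X A (pairing M (emp M) \<Gamma> A\<^sub>0 \<gamma> a) \<longleftrightarrow>
    x \<in> snd X \<gamma> \<and> a' \<in> ho_Tm H (ty_sub M (emp M) (fst X) (fst A) \<gamma>) (snd A (\<gamma>, x)) a"
  using assms by (simp add: mem_scone_ext sub_simps)

text \<open>This makes the family under the binder a legal argument of \<open>ho_Pi\<close>: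
  \<open>ty_inst_lift\<close> identifies the type index that \<open>ho_ty_fam\<close> asks for with
  the one at the point \<open>\<langle>\<gamma>, a\<rangle>\<close> of the extension.\<close>

lemma scone_under_ty_fam:
  assumes "X \<in> ob (scone_total M H)" "A \<in> Ty (scone_total M H) X"
    "B \<in> Ty (scone_total M H) (ext (scone_total M H) X A)"
    "\<gamma> \<in> hom M (emp M) (fst X)" "x \<in> snd X \<gamma>"
  shows "scone_under M H X A (snd B) (\<gamma>, x) \<in> ho_ty_fam M H
    (ty_sub M (emp M) (fst X) (fst A) \<gamma>) (snd A (\<gamma>, x)) (ty_lift M (emp M) (fst X) (fst A) (fst B) \<gamma>)"
  using assms unfolding scone_mem
  by (auto simp: scone_under_def ho_ty_fam_def ho_args_def scone_ext_eq ty_inst_lift sub_simps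
      Snoc_mem_scone_ext)

lemma scone_under_tm_fam:
  assumes "X \<in> ob (scone_total M H)" "A \<in> Ty (scone_total M H) X"
    "B \<in> Ty (scone_total M H) (ext (scone_total M H) X A)"
    "b \<in> Tm (scone_total M H) (ext (scone_total M H) X A) B"
    "\<gamma> \<in> hom M (emp M) (fst X)" "x \<in> snd X \<gamma>"
  shows "scone_under M H X A (snd b) (\<gamma>, x) \<in> ho_tm_fam M H
    (ty_sub M (emp M) (fst X) (fst A) \<gamma>) (snd A (\<gamma>, x)) (ty_lift M (emp M) (fst X) (fst A) (fst B) \<gamma>)
    (scone_under M H X A (snd B) (\<gamma>, x)) (tm_lift M (emp M) (fst X) (fst A) (fst B) (fst b) \<gamma>)"
  using assms unfolding scone_mem
  by (auto simp: scone_under_def ho_tm_fam_def ho_args_def scone_ext_eq ty_inst_lift tm_inst_lift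
      sub_simps Snoc_mem_scone_ext)

lemma scone_snd_lift:
  assumes "Y \<in> ob (scone_total M H)" "X \<in> ob (scone_total M H)" "A \<in> Ty (scone_total M H) X"
    "f \<in> hom (scone_total M H) Y X" "\<gamma> \<in> hom M (emp M) (fst Y)" "x \<in> snd Y \<gamma>"
    "a \<in> Tm M (emp M) (ty_sub M (emp M) (fst X) (fst A) (cmp M (emp M) (fst Y) (fst X) (fst f) \<gamma>))"
    "a' \<in> ho_Tm H (ty_sub M (emp M) (fst X) (fst A) (cmp M (emp M) (fst Y) (fst X) (fst f) \<gamma>))
      (snd A (cmp M (emp M) (fst Y) (fst X) (fst f) \<gamma>, snd f (\<gamma>, x))) a"
  shows "snd (lift (scone_total M H) Y X A f)
      (pairing M (emp M) (fst Y) (ty_sub M (fst Y) (fst X) (fst A) (fst f)) \<gamma> a, Snoc x a')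
    = Snoc (snd f (\<gamma>, x)) a'"
  using assms unfolding scone_mem
  by (simp add: lift_def Let_def scone_fst scone_snd sub_simps Snoc_mem_scone_ext)

text \<open>The source of stability under substitution for \<Pi>-types. Since \<open>A[f]\<close> at
  \<gamma> is \<open>A\<close> at \<open>f \<circ> \<gamma>\<close>, both functions have the same
  domain, and there \<open>lift\<close> sends the extended point to the one used on the right. The
  restricted function is the displayed component of a substitution along the lift; an arbitrary
  \<open>v\<close> covers types and terms at once.\<close>

lemma scone_under_lift:
  assumes "Y \<in> ob (scone_total M H)" "X \<in> ob (scone_total M H)" "A \<in> Ty (scone_total M H) X"
    "f \<in> hom (scone_total M H) Y X" "\<gamma> \<in> hom M (emp M) (fst Y)" "x \<in> snd Y \<gamma>"
  shows "scone_under M H Y (ty_sub (scone_total M H) Y X A f)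
      (\<lambda>(\<delta>, z) \<in> points M (ext (scone_total M H) Y (ty_sub (scone_total M H) Y X A f)).
        v (cmp M (emp M) (fst (ext (scone_total M H) Y (ty_sub (scone_total M H) Y X A f)))
              (fst (ext (scone_total M H) X A)) (fst (lift (scone_total M H) Y X A f)) \<delta>,
            snd (lift (scone_total M H) Y X A f) (\<delta>, z))) (\<gamma>, x)
    = scone_under M H X A v (cmp M (emp M) (fst Y) (fst X) (fst f) \<gamma>, snd f (\<gamma>, x))"
  using assms scone_snd_lift[OF assms] unfolding scone_mem
  by (auto simp: scone_under_def ho_args_def scone_fst scone_fst_derived scone_snd
      sub_simps lift_pairing Snoc_mem_scone_ext intro!: restrict_ext)


abbreviation T :: "('o, 'm, 'ty, 'tm, 'hty, 'htm, 'u) scone_total_data" where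
  "T \<equiv> scone_total M H"

lemmas scone_simps = scone_fst scone_fst_derived scone_snd

section \<open>Category laws\<close>

lemma scone_ident_hom: "X \<in> ob T \<Longrightarrow> ident T X \<in> hom T X X"
  by (auto simp: scone_mem scone_simps sub_simps)

lemma scone_comp_hom:
  "\<lbrakk>X \<in> ob T; Y \<in> ob T; Z \<in> ob T; f \<in> hom T X Y; g \<in> hom T Y Z\<rbrakk> \<Longrightarrow> cmp T X Y Z g f \<in> hom T X Z"
  by (auto simp: scone_mem scone_simps sub_simps)

lemma scone_comp_ident_left:
  "\<lbrakk>X \<in> ob T; Y \<in> ob T; f \<in> hom T X Y\<rbrakk> \<Longrightarrow> cmp T X Y Y (ident T Y) f = f"
  by (rule prod_eqI)
     (auto simp: scone_mem scone_simps sub_simps intro!: restrict_points_eqI)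

lemma scone_comp_ident_right:
  "\<lbrakk>X \<in> ob T; Y \<in> ob T; f \<in> hom T X Y\<rbrakk> \<Longrightarrow> cmp T X X Y f (ident T X) = f"
  by (rule prod_eqI)
     (auto simp: scone_mem scone_simps sub_simps intro!: restrict_points_eqI)

lemma scone_comp_assoc:
  "\<lbrakk>X \<in> ob T; Y \<in> ob T; Z \<in> ob T; W \<in> ob T; f \<in> hom T X Y; g \<in> hom T Y Z; h \<in> hom T Z W\<rbrakk>
    \<Longrightarrow> cmp T X Z W h (cmp T X Y Z g f) = cmp T X Y W (cmp T Y Z W h g) f"
  by (rule prod_eqI)
     (auto simp: scone_mem scone_simps sub_simps intro!: restrict_points_cong)

section \<open>Types, terms and substitution\<close>

lemma scone_ty_sub_Ty:
  "\<lbrakk>Y \<in> ob T; X \<in> ob T; A \<in> Ty T X; f \<in> hom T Y X\<rbrakk> \<Longrightarrow> ty_sub T Y X A f \<in> Ty T Y"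
  by (auto simp: scone_mem scone_simps sub_simps)

lemma scone_ty_sub_ident: "\<lbrakk>X \<in> ob T; A \<in> Ty T X\<rbrakk> \<Longrightarrow> ty_sub T X X A (ident T X) = A"
  by (rule prod_eqI)
     (auto simp: scone_mem scone_simps sub_simps intro!: restrict_points_eqI)

lemma scone_ty_sub_comp:
  "\<lbrakk>Z \<in> ob T; Y \<in> ob T; X \<in> ob T; A \<in> Ty T X; g \<in> hom T Z Y; f \<in> hom T Y X\<rbrakk>
    \<Longrightarrow> ty_sub T Z X A (cmp T Z Y X f g) = ty_sub T Z Y (ty_sub T Y X A f) g"
  by (rule prod_eqI)
     (auto simp: scone_mem scone_simps sub_simps intro!: restrict_points_cong)

lemma scone_tm_sub_Tm:
  "\<lbrakk>Y \<in> ob T; X \<in> ob T; A \<in> Ty T X; a \<in> Tm T X A; f \<in> hom T Y X\<rbrakk>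
    \<Longrightarrow> tm_sub T Y X A a f \<in> Tm T Y (ty_sub T Y X A f)"
  by (auto simp: scone_mem scone_simps sub_simps)

lemma scone_tm_sub_ident:
  "\<lbrakk>X \<in> ob T; A \<in> Ty T X; a \<in> Tm T X A\<rbrakk> \<Longrightarrow> tm_sub T X X A a (ident T X) = a"
  by (rule prod_eqI)
     (auto simp: scone_mem scone_simps sub_simps intro!: restrict_points_eqI)

lemma scone_tm_sub_comp:
  "\<lbrakk>Z \<in> ob T; Y \<in> ob T; X \<in> ob T; A \<in> Ty T X; a \<in> Tm T X A; g \<in> hom T Z Y; f \<in> hom T Y X\<rbrakk>
    \<Longrightarrow> tm_sub T Z X A a (cmp T Z Y X f g) = tm_sub T Z Y (ty_sub T Y X A f) (tm_sub T Y X A a f) g"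
  by (rule prod_eqI)
     (auto simp: scone_mem scone_simps sub_simps intro!: restrict_points_cong)

section \<open>Empty context and context extension\<close>

lemma scone_emp_ob: "emp T \<in> ob T"
  by (simp add: scone_mem scone_simps emp_ob)

text \<open>The first component is unique by terminality in \<open>M\<close>; the second is forced
  to be \<open>Star\<close> on points, as the fibres of the empty context are \<open>{Star}\<close>,
  and \<open>undefined\<close> elsewhere.\<close>

lemma scone_emp_terminal:
  assumes "X \<in> ob T"
  shows "\<exists>!f. f \<in> hom T X (emp T)"
proof -
  from assms have X: "fst X \<in> ob M"
    by (simp add: scone_mem)
  from emp_terminal[OF X] obtain u
    where u: "u \<in> hom M (fst X) (emp M)" "\<And>f. f \<in> hom M (fst X) (emp M) \<Longrightarrow> f = u"
    by (elim ex1E) blast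
  let ?u = "(u, \<lambda>_ \<in> points M X. Star)"
  show ?thesis
  proof (rule ex1I[of _ ?u])
    show "?u \<in> hom T X (emp T)"
      using u(1) X by (simp add: scone_mem scone_simps sub_simps)
  next
    fix f assume f: "f \<in> hom T X (emp T)"
    then have "fst f = u"
      using u(2) by (simp add: scone_mem scone_simps)
    moreover have "snd f = (\<lambda>_ \<in> points M X. Star)"
      by (rule sym, rule restrict_points_eqI)
        (use f X in \<open>auto simp: scone_mem scone_simps sub_simps\<close>)
    ultimately show "f = ?u"
      by (simp add: prod_eq_iff)
  qed
qed

lemma scone_ext_ob: "\<lbrakk>X \<in> ob T; A \<in> Ty T X\<rbrakk> \<Longrightarrow> ext T X A \<in> ob T"
  by (simp add: scone_mem scone_simps sub_simps) (simp add: scone_ext_def Let_def)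

lemma scone_wk_hom: "\<lbrakk>X \<in> ob T; A \<in> Ty T X\<rbrakk> \<Longrightarrow> wk T X A \<in> hom T (ext T X A) X"
  by (auto simp: scone_mem scone_simps sub_simps mem_scone_ext)

lemma scone_vz_Tm:
  "\<lbrakk>X \<in> ob T; A \<in> Ty T X\<rbrakk> \<Longrightarrow> vz T X A \<in> Tm T (ext T X A) (ty_sub T (ext T X A) X A (wk T X A))"
  by (auto simp: scone_mem scone_simps sub_simps mem_scone_ext)

lemma scone_pairing_hom:
  "\<lbrakk>Y \<in> ob T; X \<in> ob T; A \<in> Ty T X; f \<in> hom T Y X; a \<in> Tm T Y (ty_sub T Y X A f)\<rbrakk>
    \<Longrightarrow> pairing T Y X A f a \<in> hom T Y (ext T X A)"
  by (auto simp: scone_mem scone_simps sub_simps Snoc_mem_scone_ext)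

lemma scone_wk_pairing:
  "\<lbrakk>Y \<in> ob T; X \<in> ob T; A \<in> Ty T X; f \<in> hom T Y X; a \<in> Tm T Y (ty_sub T Y X A f)\<rbrakk>
    \<Longrightarrow> cmp T Y (ext T X A) X (wk T X A) (pairing T Y X A f a) = f"
  by (rule prod_eqI)
     (auto simp: scone_mem scone_simps sub_simps Snoc_mem_scone_ext intro!: restrict_points_eqI)

lemma scone_vz_pairing:
  "\<lbrakk>Y \<in> ob T; X \<in> ob T; A \<in> Ty T X; f \<in> hom T Y X; a \<in> Tm T Y (ty_sub T Y X A f)\<rbrakk>
    \<Longrightarrow> tm_sub T Y (ext T X A) (ty_sub T (ext T X A) X A (wk T X A)) (vz T X A) (pairing T Y X A f a) = a"
  by (rule prod_eqI)
     (auto simp: scone_mem scone_simps sub_simps Snoc_mem_scone_ext intro!: restrict_points_eqI)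

text \<open>The two projections together lose nothing: by \<open>mem_scone_ext\<close> every element
  in a fibre of an extension is a \<open>Snoc\<close>, never an \<open>Atom\<close> or
  \<open>Star\<close>.\<close>

lemma scone_pairing_eta:
  assumes "Y \<in> ob T" "X \<in> ob T" "A \<in> Ty T X" "h \<in> hom T Y (ext T X A)"
  shows "pairing T Y X A (cmp T Y (ext T X A) X (wk T X A) h)
    (tm_sub T Y (ext T X A) (ty_sub T (ext T X A) X A (wk T X A)) (vz T X A) h) = h"
proof -
  have "Snoc (snoc_init (snd h (\<gamma>, x))) (snoc_last (snd h (\<gamma>, x))) = snd h (\<gamma>, x)"
    if "\<gamma> \<in> hom M (emp M) (fst Y)" "x \<in> snd Y \<gamma>" for \<gamma> x
    using assms that
      mem_scone_ext[of "cmp M (emp M) (fst Y) (ext M (fst X) (fst A)) (fst h) \<gamma>" X A "snd h (\<gamma>, x)"]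
    by (auto simp: scone_mem scone_simps sub_simps)
  then show ?thesis
    by (intro prod_eqI)
       (use assms in \<open>auto simp: scone_mem scone_simps sub_simps intro!: restrict_points_eqI\<close>)
qed

section \<open>\<Pi>-types: formation, introduction, elimination and \<beta>\<close>

lemma scone_PiT_Ty: "\<lbrakk>X \<in> ob T; A \<in> Ty T X; B \<in> Ty T (ext T X A)\<rbrakk> \<Longrightarrow> PiT T X A B \<in> Ty T X"
  using scone_under_ty_fam[of X A B]
  by (auto simp: scone_mem scone_simps sub_simps PiT_sub ty_lift_Ty intro!: ho_Pi_Ty)

lemma scone_lam_Tm:
  "\<lbrakk>X \<in> ob T; A \<in> Ty T X; B \<in> Ty T (ext T X A); b \<in> Tm T (ext T X A) B\<rbrakk>
    \<Longrightarrow> lam T X A B b \<in> Tm T X (PiT T X A B)"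
  using scone_under_ty_fam[of X A B] scone_under_tm_fam[of X A B b]
  by (auto simp: scone_mem scone_simps sub_simps PiT_sub lam_sub ty_lift_Ty tm_lift_Tm intro!: ho_lam_Tm)

text \<open>Instantiation at \<open>a\<close> takes the point \<open>(\<gamma>, x)\<close> to
  \<open>\<langle>\<gamma>, a[\<gamma>]\<rangle>\<close> together with \<open>Snoc x a'\<close>,
  where \<open>a'\<close> is the value of \<open>a\<close> there. This translates
  \<open>B\<^sup>\<bullet>(a\<^sup>\<bullet>)\<close> of the higher-order model into the value of
  \<open>B[a]\<close> in the scone.\<close>

lemma scone_snd_under_inst:
  assumes "X \<in> ob T" "A \<in> Ty T X" "a \<in> Tm T X A" "\<gamma> \<in> hom M (emp M) (fst X)" "x \<in> snd X \<gamma>"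
  shows "scone_under M H X A v (\<gamma>, x) (tm_sub M (emp M) (fst X) (fst A) (fst a) \<gamma>, snd a (\<gamma>, x))
    = v (cmp M (emp M) (fst X) (ext M (fst X) (fst A)) (inst M (fst X) (fst A) (fst a)) \<gamma>,
        snd (inst T X A a) (\<gamma>, x))"
  using assms
  by (simp add: scone_mem scone_simps scone_under_def ho_args_def sub_simps inst_comp)
     (simp add: inst_def scone_simps)

lemma scone_app_Tm:
  assumes "X \<in> ob T" "A \<in> Ty T X" "B \<in> Ty T (ext T X A)" "t \<in> Tm T X (PiT T X A B)" "a \<in> Tm T X A"
  shows "app T X A B t a \<in> Tm T X (ty_inst T X A B a)"
proof -
  note mem = assms[unfolded scone_mem scone_simps]
  have "snd (app T X A B t a) (\<gamma>, x) \<in>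
    ho_Tm H (ty_sub M (emp M) (fst X) (fst (ty_inst T X A B a)) \<gamma>) (snd (ty_inst T X A B a) (\<gamma>, x))
      (tm_sub M (emp M) (fst X) (fst (ty_inst T X A B a)) (fst (app T X A B t a)) \<gamma>)"
    if p: "\<gamma> \<in> hom M (emp M) (fst X)" "x \<in> snd X \<gamma>" for \<gamma> x
  proof -
    let ?A = "ty_sub M (emp M) (fst X) (fst A) \<gamma>"
    let ?B = "ty_lift M (emp M) (fst X) (fst A) (fst B) \<gamma>"
    let ?t = "tm_sub M (emp M) (fst X) (PiT M (fst X) (fst A) (fst B)) (fst t) \<gamma>"
    let ?a = "tm_sub M (emp M) (fst X) (fst A) (fst a) \<gamma>"
    have "ho_app H ?A (snd A (\<gamma>, x)) ?B (scone_under M H X A (snd B) (\<gamma>, x)) ?t (snd t (\<gamma>, x)) ?a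
        (snd a (\<gamma>, x))
      \<in> ho_Tm H (ty_inst M (emp M) ?A ?B ?a) (scone_under M H X A (snd B) (\<gamma>, x) (?a, snd a (\<gamma>, x)))
        (app M (emp M) ?A ?B ?t ?a)"
      by (rule ho_app_Tm[OF _ _ _ scone_under_ty_fam[OF assms(1-3) p]])
        (use mem p in \<open>auto simp: sub_simps ty_lift_Ty PiT_sub\<close>)
    \<comment> \<open>It remains to match indices: \<open>app_sub\<close> handles the term, and
      \<open>scone_snd_under_inst\<close> turns the family applied to the argument into the
      displayed \<open>B[a]\<close>.\<close>
    with mem p show ?thesis
      by (simp add: scone_simps ty_inst_sub ty_inst_lift app_sub sub_simps
          scone_snd_under_inst[OF assms(1,2,5) p])
        (simp add: ty_inst_def scone_simps)
  qed
  with mem show ?thesis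
    unfolding scone_mem
    by (simp add: scone_fst scone_fst_derived app_Tm) (simp add: scone_snd)
qed

lemma scone_app_lam:
  assumes "X \<in> ob T" "A \<in> Ty T X" "B \<in> Ty T (ext T X A)" "b \<in> Tm T (ext T X A) B" "a \<in> Tm T X A"
  shows "app T X A B (lam T X A B b) a = tm_inst T X A B b a"
proof (rule prod_eqI)
  note mem = assms[unfolded scone_mem scone_simps]
  show "fst (app T X A B (lam T X A B b) a) = fst (tm_inst T X A B b a)"
    using mem by (simp add: scone_fst scone_fst_derived app_lam)
  have "ho_app H (ty_sub M (emp M) (fst X) (fst A) \<gamma>) (snd A (\<gamma>, x))
      (ty_lift M (emp M) (fst X) (fst A) (fst B) \<gamma>) (scone_under M H X A (snd B) (\<gamma>, x))
      (tm_sub M (emp M) (fst X) (PiT M (fst X) (fst A) (fst B)) (lam M (fst X) (fst A) (fst B) (fst b)) \<gamma>)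
      (ho_lam H (ty_sub M (emp M) (fst X) (fst A) \<gamma>) (snd A (\<gamma>, x))
        (ty_lift M (emp M) (fst X) (fst A) (fst B) \<gamma>) (scone_under M H X A (snd B) (\<gamma>, x))
        (tm_lift M (emp M) (fst X) (fst A) (fst B) (fst b) \<gamma>) (scone_under M H X A (snd b) (\<gamma>, x)))
      (tm_sub M (emp M) (fst X) (fst A) (fst a) \<gamma>) (snd a (\<gamma>, x))
    = snd b (cmp M (emp M) (fst X) (ext M (fst X) (fst A)) (inst M (fst X) (fst A) (fst a)) \<gamma>,
        snd (inst T X A a) (\<gamma>, x))"
    if p: "\<gamma> \<in> hom M (emp M) (fst X)" "x \<in> snd X \<gamma>" for \<gamma> x
    \<comment> \<open>Read from right to left, this presents the right side as \<open>b\<close>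
      under the binder applied to the argument, as in \<open>ho_app_lam\<close>.\<close>
    unfolding scone_snd_under_inst[OF assms(1,2,5) p, symmetric]
    using mem p
    by (subst lam_sub, simp_all add: emp_ob)
      (rule ho_app_lam[OF _ _ _ scone_under_ty_fam[OF assms(1-3) p] _
            scone_under_tm_fam[OF assms(1-4) p]],
       auto simp: sub_simps ty_lift_Ty tm_lift_Tm)
  then show "snd (app T X A B (lam T X A B b) a) = snd (tm_inst T X A B b a)"
    unfolding scone_snd tm_inst_def
    by (intro restrict_points_cong) (simp add: scone_fst scone_fst_derived)
qed

section \<open>\<Pi>-types: stability under substitution and \<eta>\<close>

lemma scone_under_ty_lift:
  assumes "Y \<in> ob T" "X \<in> ob T" "A \<in> Ty T X" "f \<in> hom T Y X"
    "\<gamma> \<in> hom M (emp M) (fst Y)" "x \<in> snd Y \<gamma>"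
  shows "scone_under M H Y (ty_sub T Y X A f) (snd (ty_lift T Y X A B f)) (\<gamma>, x)
    = scone_under M H X A (snd B) (cmp M (emp M) (fst Y) (fst X) (fst f) \<gamma>, snd f (\<gamma>, x))"
  unfolding ty_lift_def scone_snd(3) by (rule scone_under_lift[OF assms])

lemma scone_under_tm_lift:
  assumes "Y \<in> ob T" "X \<in> ob T" "A \<in> Ty T X" "f \<in> hom T Y X"
    "\<gamma> \<in> hom M (emp M) (fst Y)" "x \<in> snd Y \<gamma>"
  shows "scone_under M H Y (ty_sub T Y X A f) (snd (tm_lift T Y X A B b f)) (\<gamma>, x)
    = scone_under M H X A (snd b) (cmp M (emp M) (fst Y) (fst X) (fst f) \<gamma>, snd f (\<gamma>, x))"
  unfolding tm_lift_def scone_snd(4) by (rule scone_under_lift[OF assms])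

text \<open>At each point both sides are \<open>ho_Pi\<close> of the same data: the domains agree by
  functoriality of substitution, the codomains by \<open>ty_lift_lift\<close>, the displayed
  families by \<open>scone_under_ty_lift\<close>.\<close>

lemma scone_PiT_sub:
  assumes "Y \<in> ob T" "X \<in> ob T" "A \<in> Ty T X" "B \<in> Ty T (ext T X A)" "f \<in> hom T Y X"
  shows "ty_sub T Y X (PiT T X A B) f = PiT T Y (ty_sub T Y X A f) (ty_lift T Y X A B f)"
  by (intro prod_eqI)
     (use assms in \<open>auto simp: scone_mem scone_fst scone_fst_derived scone_snd(3,10) PiT_sub sub_simps
      ty_lift_lift scone_under_ty_lift[OF assms(1-3,5)] intro!: restrict_points_cong\<close>)

lemma scone_lam_sub:
  assumes "Y \<in> ob T" "X \<in> ob T" "A \<in> Ty T X" "B \<in> Ty T (ext T X A)" "b \<in> Tm T (ext T X A) B"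
    "f \<in> hom T Y X"
  shows "tm_sub T Y X (PiT T X A B) (lam T X A B b) f
    = lam T Y (ty_sub T Y X A f) (ty_lift T Y X A B f) (tm_lift T Y X A B b f)"
  by (intro prod_eqI)
     (use assms in \<open>auto simp: scone_mem scone_fst scone_fst_derived scone_snd(3,4,11) lam_sub sub_simps
      ty_lift_lift tm_lift_lift scone_under_ty_lift[OF assms(1-3,6)] scone_under_tm_lift[OF assms(1-3,6)]
      intro!: restrict_points_cong\<close>)

lemma scone_app_sub:
  assumes "Y \<in> ob T" "X \<in> ob T" "A \<in> Ty T X" "B \<in> Ty T (ext T X A)" "t \<in> Tm T X (PiT T X A B)"
    "a \<in> Tm T X A" "f \<in> hom T Y X"
  shows "tm_sub T Y X (ty_inst T X A B a) (app T X A B t a) f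
    = app T Y (ty_sub T Y X A f) (ty_lift T Y X A B f)
        (tm_sub T Y X (PiT T X A B) t f) (tm_sub T Y X A a f)"
  \<comment> \<open>Reversing \<open>PiT_sub\<close> writes the type of \<open>t[f]\<close> as an
    instance along \<open>f\<close>, so that the later substitution of \<gamma> fuses with
    it.\<close>
  by (intro prod_eqI)
     (use assms in \<open>auto simp: scone_mem scone_fst scone_fst_derived scone_snd(3,4,12) app_sub sub_simps
      ty_lift_lift scone_under_ty_lift[OF assms(1-3,7)] simp flip: PiT_sub
      intro!: restrict_points_cong\<close>)

text \<open>At an extended point weakening returns \<open>(\<gamma>, x)\<close> and the last
  variable returns \<open>a\<close> and \<open>a'\<close>, so the generic application there is
  \<open>ho_app\<close> of the values at \<open>(\<gamma>, x)\<close>. This is exactly the function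
  that \<open>ho_lam_app\<close> abstracts.\<close>

lemma scone_under_app_vz:
  assumes "X \<in> ob T" "A \<in> Ty T X" "B \<in> Ty T (ext T X A)" "t \<in> Tm T X (PiT T X A B)"
    and p: "\<gamma> \<in> hom M (emp M) (fst X)" "x \<in> snd X \<gamma>"
  shows "scone_under M H X A (snd (app_vz T X A B t)) (\<gamma>, x)
    = (\<lambda>(a, a') \<in> ho_args M H (ty_sub M (emp M) (fst X) (fst A) \<gamma>) (snd A (\<gamma>, x)).
        ho_app H (ty_sub M (emp M) (fst X) (fst A) \<gamma>) (snd A (\<gamma>, x))
          (ty_lift M (emp M) (fst X) (fst A) (fst B) \<gamma>) (scone_under M H X A (snd B) (\<gamma>, x))
          (tm_sub M (emp M) (fst X) (PiT M (fst X) (fst A) (fst B)) (fst t) \<gamma>) (snd t (\<gamma>, x)) a a')"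
  unfolding scone_under_def[of M H X A "snd (app_vz T X A B t)"] split_conv
proof (rule restrict_ext, clarify)
  fix a a' assume "(a, a') \<in> ho_args M H (ty_sub M (emp M) (fst X) (fst A) \<gamma>) (snd A (\<gamma>, x))"
  then have a: "a \<in> Tm M (emp M) (ty_sub M (emp M) (fst X) (fst A) \<gamma>)"
    "a' \<in> ho_Tm H (ty_sub M (emp M) (fst X) (fst A) \<gamma>) (snd A (\<gamma>, x)) a"
    by (auto simp: ho_args_def)
  let ?\<delta> = "pairing M (emp M) (fst X) (fst A) \<gamma> a"
  let ?z = "Snoc x a'"
  note mem = assms(1-4)[unfolded scone_mem scone_fst]
  have d: "?\<delta> \<in> hom M (emp M) (fst (ext T X A))" "?z \<in> snd (ext T X A) ?\<delta>"
    using mem p a by (simp_all add: scone_fst scone_snd(6) sub_simps Snoc_mem_scone_ext)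
  \<comment> \<open>Stability along \<open>wk\<close> at the extended point: the weakened family
    there is the original family at \<open>(\<gamma>, x)\<close>, since \<open>wk\<close> undoes the
    extension.\<close>
  note under = scone_under_ty_lift[OF scone_ext_ob assms(1,2) scone_wk_hom d, OF assms(1,2) assms(1,2)]
  show "snd (app_vz T X A B t) (?\<delta>, ?z) =
    ho_app H (ty_sub M (emp M) (fst X) (fst A) \<gamma>) (snd A (\<gamma>, x))
          (ty_lift M (emp M) (fst X) (fst A) (fst B) \<gamma>) (scone_under M H X A (snd B) (\<gamma>, x))
          (tm_sub M (emp M) (fst X) (PiT M (fst X) (fst A) (fst B)) (fst t) \<gamma>) (snd t (\<gamma>, x)) a a'"
    using mem p a d unfolding app_vz_def scone_snd(12)
    by (simp add: under scone_fst scone_fst_derived scone_snd(3,4,6,7,8) sub_simps ty_lift_lift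
        Snoc_mem_scone_ext flip: PiT_sub)
qed

lemma scone_lam_app:
  assumes "X \<in> ob T" "A \<in> Ty T X" "B \<in> Ty T (ext T X A)" "t \<in> Tm T X (PiT T X A B)"
  shows "lam T X A B (app_vz T X A B t) = t"
proof (rule prod_eqI)
  note mem = assms[unfolded scone_mem scone_fst]
  show "fst (lam T X A B (app_vz T X A B t)) = fst t"
    using mem by (simp add: scone_fst scone_fst_derived lam_app)
  have "ho_lam H (ty_sub M (emp M) (fst X) (fst A) \<gamma>) (snd A (\<gamma>, x))
      (ty_lift M (emp M) (fst X) (fst A) (fst B) \<gamma>) (scone_under M H X A (snd B) (\<gamma>, x))
      (tm_lift M (emp M) (fst X) (fst A) (fst B) (fst (app_vz T X A B t)) \<gamma>)
      (scone_under M H X A (snd (app_vz T X A B t)) (\<gamma>, x)) = snd t (\<gamma>, x)"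
    if p: "\<gamma> \<in> hom M (emp M) (fst X)" "x \<in> snd X \<gamma>" for \<gamma> x
    \<comment> \<open>The displayed part becomes the function abstracted in
      \<open>ho_lam_app\<close>; \<open>app_vz_sub\<close> then makes the underlying term an
      \<open>app_vz\<close> over the empty context.\<close>
    unfolding scone_under_app_vz[OF assms p] scone_fst_derived
    using mem p scone_snd(10)[of M H X A B]
    by (subst app_vz_sub)
      (auto simp: PiT_sub ty_lift_Ty sub_simps scone_under_ty_fam[OF assms(1-3) p] intro!: ho_lam_app)
  with mem show "snd (lam T X A B (app_vz T X A B t)) = snd t"
    unfolding scone_snd(11) by (intro restrict_points_eqI) simp_all
qed

lemma cwf_pi_scone_total: "cwf_pi T"
  by (rule cwf_pi.intro; rule scone_ident_hom scone_comp_hom scone_comp_ident_left scone_comp_ident_right scone_comp_assoc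
    scone_ty_sub_Ty scone_ty_sub_ident scone_ty_sub_comp scone_tm_sub_Tm scone_tm_sub_ident scone_tm_sub_comp scone_emp_ob
    scone_emp_terminal scone_ext_ob scone_wk_hom scone_vz_Tm scone_pairing_hom scone_wk_pairing scone_vz_pairing scone_pairing_eta
    scone_PiT_Ty scone_PiT_sub scone_lam_Tm scone_lam_sub scone_app_Tm scone_app_sub scone_app_lam scone_lam_app; assumption)

end

theorem mainTheorem1:
  fixes S :: "('o, 'm, 'ty, 'tm) cwf_pi_data"
    and H :: "('ty, 'tm, 'hty, 'htm) ho_data"
  assumes "initial_model TYPE(('o, 'm, 'ty, 'tm, 'hty, 'htm, 'u) scone_total_data) S"
    and "displayed_ho_model S H"
  shows "admits_section S (scone S H :: ('o, 'm, 'ty, 'tm, 'hty, 'htm, 'u) scone_data)"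
proof -
  let ?D = "scone S H :: ('o, 'm, 'ty, 'tm, 'hty, 'htm, 'u) scone_data"
  interpret displayed_ho_model S H
    by (rule assms(2))
  have "cwf_pi (total_model S ?D)"
    using cwf_pi_scone_total by (simp add: scone_total_def)
  \<comment> \<open>Initiality is assumed at exactly the carrier types of this total model.\<close>
  then obtain F where F: "cwf_pi_morphism S (total_model S ?D) F"
    using assms(1) by (auto simp: initial_model_def)
  then have "map_eq S (map_comp total_proj F) map_id"
    by (intro initial_model_endo[OF assms(1)] cwf_pi_morphism_proj)
  with F show ?thesis
    by (auto simp: admits_section_def is_section_def)
qed

end
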